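(* Let $q$ be a prime power. (i) An $\mathbf{F}_q$-linear pure $[[n,n-2d+2-r,r,d]]_q$ MDS subsystem code exists for all $n$, $d$, and $r$ such that $3\le n\le q$, $1\le d\le n/2+1$, and $0\le r\le n-2d+1$. (ii) An $\mathbf{F}_q$-linear pure $[[(\nu+1)q,(\nu+1)q-2\nu-2-r,r,\nu+2]]_q$ MDS subsystem code exists for all $\nu$ and $r$ such that $0\le\nu\le q-2$ and $0\le r\le(\nu+1)q-2\nu-3$. (iii) An $\mathbf{F}_q$-linear pure $[[q-1,q-1-2\delta-r,r,\delta+1]]_q$ MDS subsystem code exists for all $\delta$ and $r$ such that $0\le\delta<(q-1)/2$ and $0\le r\le q-2\delta-1$. (iv) An $\mathbf{F}_q$-linear pure $[[q,q-2\delta-2-r',r',\delta+2]]_q$ MDS subsystem code exists for all $0\le\delta<(q-1)/2$ and $0\le r'<q-2\delta-2$. (v) An $\mathbf{F}_q$-linear pure $[[q^2-1,q^2-2\delta-1-r,r,\delta+1]]_q$ MDS subsystem code exists for all $\delta$ and $r$ in the range $0\le\delta<q-1$ and $0\le r<q^2-2\delta-1$. (vi) An $\mathbf{F}_q$-linear pure $[[q^2,q^2-2\delta-2-r',r',\delta+2]]_q$ MDS subsystem code exists for all $\delta$ and $r'$ in the range $0\le\delta<q-1$ and $0\le r'<q^2-2\delta-2$. (All of $n,d,r,r',\nu,\delta$ are integers.)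
   Context: Let $p$ be the characteristic of $\mathbf{F}_q$. For $(x|y)\in\mathbf{F}_q^{2n}$ (with $x,y\in\mathbf{F}_q^n$), $\mathrm{swt}(x|y)$ is the number of $i$ with $(x_i,y_i)\ne(0,0)$, and $\mathrm{swt}(S)$ is the minimum of $\mathrm{swt}$ over the nonzero elements of $S$. The trace-symplectic product of $(a|b)$ and $(a'|b')$ is $\mathrm{tr}_{q/p}(a'\cdot b-a\cdot b')$, and $C^{\perp_s}$ is the dual of $C\subseteq\mathbf{F}_q^{2n}$ with respect to it. All subsystem codes are Clifford subsystem codes: an $((n,K,R,d))_q$ subsystem code is a subspace $Q=A\otimes B$ of $\mathbf{C}^{q^n}$, $\dim A=K$, $\dim B=R$, arising from an additive code; concretely, its existence means that there is an additive subgroup $C\le\mathbf{F}_q^{2n}$ (the zero code is allowed) with $D=C\cap C^{\perp_s}$ such that $|C|=q^nR/K$, $|D|=q^n/(KR)$, and $d=\mathrm{swt}(D^{\perp_s}\setminus C)$ if $D^{\perp_s}\ne C$, while $d=\mathrm{swt}(D^{\perp_s})$ if $D^{\perp_s}=C$ (the case $K=1$). The subsystem code is $\mathbf{F}_q$-linear if $C$ is an $\mathbf{F}_q$-linear subspace of $\mathbf{F}_q^{2n}$. $[[n,k,r,d]]_q$ means $((n,q^k,q^r,d))_q$. The code derived from $C$ is pure to $d'$ if $C$ contains no nonzero element of symplectic weight less than $d'$; it is pure if it is pure to its minimum distance $d$. An $\mathbf{F}_q$-linear $[[n,k,r,d]]_q$ subsystem code is called MDS if it attains the Singleton bound $k+r\le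 n-2d+2$ with equality. *)

theory Defs
  imports
    "HOL-Computational_Algebra.Primes"
    "HOL-Library.Cardinality"
    "HOL-Algebra.Group"
    "Jordan_Normal_Form.Matrix"
begin

text \<open>
  The field \<open>F_q\<close> is a type of class \<open>finite_field\<close>, with \<open>q = CARD('a)\<close> and \<open>p = CHAR('a)\<close>.
  An element \<open>(x|y)\<close> of \<open>F_q^{2n}\<close> is a pair of vectors in \<open>carrier_vec n\<close>, so that the length
  \<open>n\<close> is an ordinary natural number.
\<close>

definition symp_space :: "nat \<Rightarrow> ('a vec \<times> 'a vec) set" where
  "symp_space n = carrier_vec n \<times> carrier_vec n"

definition swt :: "'a::zero vec \<times> 'a vec \<Rightarrow> nat" where
  "swt v = card {i. i < dim_vec (fst v) \<and> (fst v $ i, snd v $ i) \<noteq> (0, 0)}"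

text \<open>Only meaningful if \<open>S\<close> is finite and has a nonzero element.\<close>

definition min_swt :: "nat \<Rightarrow> ('a::zero vec \<times> 'a vec) set \<Rightarrow> nat" where
  "min_swt n S = Min (swt ` (S - {(0\<^sub>v n, 0\<^sub>v n)}))"

text \<open>
  The trace from \<open>F_q\<close> to its prime field \<open>F_p\<close>, with values in the copy of \<open>F_p\<close> inside \<open>'a\<close>:
  \<open>tr(x) = x + x^p + ... + x^(p^(m-1))\<close> where \<open>q = p^m\<close>.
\<close>

definition ext_degree :: "'a::finite_field itself \<Rightarrow> nat" where
  "ext_degree _ = (THE m. CARD('a) = CHAR('a) ^ m)"

definition field_trace :: "'a::finite_field \<Rightarrow> 'a" where
  "field_trace x = (\<Sum>i<ext_degree TYPE('a). x ^ (CHAR('a) ^ i))"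

definition trace_symp :: "'a::finite_field vec \<times> 'a vec \<Rightarrow> 'a vec \<times> 'a vec \<Rightarrow> 'a" where
  "trace_symp v w = field_trace (fst w \<bullet> snd v - fst v \<bullet> snd w)"

definition symp_dual ::
    "nat \<Rightarrow> ('a::finite_field vec \<times> 'a vec) set \<Rightarrow> ('a vec \<times> 'a vec) set" where
  "symp_dual n C = {v \<in> symp_space n. \<forall>c\<in>C. trace_symp v c = 0}"

definition additive_code :: "nat \<Rightarrow> ('a::finite_field vec \<times> 'a vec) set \<Rightarrow> bool" where
  "additive_code n C \<longleftrightarrow>
     subgroup C (monoid_vec TYPE('a) n \<times>\<times> monoid_vec TYPE('a) n)"

definition linear_code :: "nat \<Rightarrow> ('a::finite_field vec \<times> 'a vec) set \<Rightarrow> bool" where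
  "linear_code n C \<longleftrightarrow>
     additive_code n C \<and> (\<forall>a. \<forall>(x, y)\<in>C. (a \<cdot>\<^sub>v x, a \<cdot>\<^sub>v y) \<in> C)"

text \<open>\<open>C\<close> gives rise to a Clifford subsystem code with parameters \<open>((n, K, R, d))_q\<close>.\<close>

definition subsystem_code ::
    "('a::finite_field vec \<times> 'a vec) set \<Rightarrow> nat \<Rightarrow> nat \<Rightarrow> nat \<Rightarrow> nat \<Rightarrow> bool" where
  "subsystem_code C n K R d \<longleftrightarrow>
     additive_code n C \<and>
     (let D = C \<inter> symp_dual n C in
        real (card C) = real CARD('a) ^ n * real R / real K \<and>
        real (card D) = real CARD('a) ^ n / (real K * real R) \<and>
        d = (if symp_dual n D \<noteq> C then min_swt n (symp_dual n D - C)
             else min_swt n (symp_dual n D)))"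

text \<open>\<open>[[n, k, r, d]]_q\<close>\<close>

definition subsystem_code_log ::
    "('a::finite_field vec \<times> 'a vec) set \<Rightarrow> nat \<Rightarrow> nat \<Rightarrow> nat \<Rightarrow> nat \<Rightarrow> bool" where
  "subsystem_code_log C n k r d \<longleftrightarrow> subsystem_code C n (CARD('a) ^ k) (CARD('a) ^ r) d"

definition pure_to :: "nat \<Rightarrow> nat \<Rightarrow> ('a::finite_field vec \<times> 'a vec) set \<Rightarrow> bool" where
  "pure_to n d' C \<longleftrightarrow> (\<forall>c\<in>C. c \<noteq> (0\<^sub>v n, 0\<^sub>v n) \<longrightarrow> d' \<le> swt c)"

definition linear_MDS ::
    "('a::finite_field vec \<times> 'a vec) set \<Rightarrow> nat \<Rightarrow> nat \<Rightarrow> nat \<Rightarrow> nat \<Rightarrow> bool" where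
  "linear_MDS C n k r d \<longleftrightarrow>
     linear_code n C \<and> subsystem_code_log C n k r d \<and>
     int k + int r = int n - 2 * int d + 2"

text \<open>
  The parameters are integers, so that expressions such as \<open>n - 2 * d + 2 - r\<close> can be
  written without truncated subtraction.
\<close>

definition pure_linear_MDS_exists ::
    "'a::finite_field itself \<Rightarrow> int \<Rightarrow> int \<Rightarrow> int \<Rightarrow> int \<Rightarrow> bool" where
  "pure_linear_MDS_exists _ n k r d \<longleftrightarrow>
     0 \<le> n \<and> 0 \<le> k \<and> 0 \<le> r \<and> 0 \<le> d \<and>
     (\<exists>C :: ('a vec \<times> 'a vec) set.
        linear_MDS C (nat n) (nat k) (nat r) (nat d) \<and> pure_to (nat n) (nat d) C)"

end

theory Submission
  imports Defs "HOL-Computational_Algebra.Polynomial"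
begin

text \<open>
  Put \<open>m = d - 1\<close>. Suppose \<open>D\<close> is a self-orthogonal linear code with \<open>q\<^sup>2\<^sup>m\<close> elements whose dual has
  minimum weight at least \<open>m + 1\<close>. Adjoining \<open>r\<close> hyperbolic pairs from the dual gives a code \<open>C\<close> with
  radical \<open>D\<close>, and purity is automatic because \<open>C\<close> lies in the dual of \<open>D\<close>. The distance is
  exactly \<open>m + 1\<close> because the dual is MDS and hence spanned by its words of weight \<open>m + 1\<close>.

  Such a \<open>D\<close> is a generalized Reed-Solomon code over \<open>F_{q^2} = F_q^2\<close>, evaluated at points \<open>(a, b)\<close>
  of a set \<open>S\<close>. It is self-orthogonal if there are nonzero weights on \<open>S\<close> that annihilate all
  polynomials in \<open>a, b\<close> of total degree at most \<open>2m - 2\<close>. On a grid \<open>A \<times> T\<close>, the products of the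
  Lagrange weights of \<open>A\<close> and \<open>T\<close> annihilate total degree less than \<open>|A| + |T| - 2\<close>. The lengths in
  the theorem come from the grids with \<open>|A| = 1\<close> (i, iii, iv), \<open>A = F_q\<close> and \<open>|T| = \<nu> + 1\<close> (ii),
  \<open>A = T = F_q\<close> (vi), and the last one without the origin (v).
\<close>

subsection \<open>The trace\<close>

text \<open>The characteristic is prime, so Bezout inverts \<open>d\<close> modulo it, and the
  multiple of the characteristic vanishes in the field.\<close>

lemma inverse_mod_CHAR:
  assumes "0 < d" "d < CHAR('a::finite_field)"
  obtains e where "of_nat (d * e) = (1 :: 'a)"
proof -
  have "prime CHAR('a)"
    using prime_CHAR_semidom[where ?'a = 'a] CHAR_pos[where ?'a = 'a] by auto
  then have "coprime d CHAR('a)"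
    using assms by (metis coprime_commute prime_imp_coprime nat_dvd_not_less)
  then obtain x y where "d * x = CHAR('a) * y + 1"
    using bezout_nat[of d "CHAR('a)"] assms by (auto simp: coprime_iff_gcd_eq_1)
  then show thesis
    using that[of x] by (simp only: of_nat_add of_nat_mult[of "CHAR('a)"]) simp
qed

text \<open>Take a largest additive subgroup whose order is a power of the characteristic
  \<open>?p\<close>. An element outside it would give a subgroup \<open>?p\<close> times as large,
  so it is the whole field.\<close>

lemma card_finite_field_eq_CHAR_power: "\<exists>m. CARD('a::finite_field) = CHAR('a) ^ m"
proof -
  let ?p = "CHAR('a)"
  define sub where
    "sub H \<longleftrightarrow> 0 \<in> H \<and> (\<forall>x\<in>H. \<forall>y\<in>H. x + y \<in> H) \<and> (\<exists>k. card H = ?p ^ k)" for H :: "'a set"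
  have "sub {0}"
    by (auto simp: sub_def intro: exI[of _ 0])
  then obtain H where H: "sub H" and max: "\<And>H'. sub H' \<Longrightarrow> card H' \<le> card H"
    using ex_has_greatest_nat[of sub "{0}" card "Suc CARD('a)"]
    by (metis card_mono finite_class.finite_UNIV subset_UNIV le_imp_less_Suc)
  have p0: "?p > 1"
    using prime_CHAR_semidom[where ?'a = 'a] CHAR_pos[where ?'a = 'a] prime_gt_1_nat by auto
  have add: "x + y \<in> H" if "x \<in> H" "y \<in> H" for x y
    using H that by (auto simp: sub_def)
  have mult: "of_nat e * x \<in> H" if "x \<in> H" for e x
    using that H by (induction e) (auto simp: sub_def distrib_right)
  have neg: "- x \<in> H" if "x \<in> H" for x
  proof -
    \<comment> \<open>\<open>sub\<close> asks only for closure under addition; negation is a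
      repeated addition.\<close>
    have "of_nat (?p - 1) * x = - x"
      using p0 by (simp add: of_nat_diff)
    then show ?thesis using mult[OF that] by metis
  qed
  have "H = UNIV"
  proof (rule ccontr)
    assume "H \<noteq> UNIV"
    then obtain x where x: "x \<notin> H" by auto
    let ?f = "\<lambda>(h, i :: nat). h + of_nat i * x"
    define H' where "H' = ?f ` (H \<times> {..<?p})"
    \<comment> \<open>The translates of \<open>H\<close> by multiples of \<open>x\<close> are
      disjoint: otherwise \<open>(j - i) x\<close> lies in \<open>H\<close>, and multiplying by the
      inverse \<open>e\<close> of \<open>j - i\<close> puts \<open>x\<close> there.\<close>
    have no: False if "h + of_nat i * x = h' + of_nat j * x" "h \<in> H" "h' \<in> H" "i < j" "j < ?p"
      for h h' i j
    proof -
      have "0 < j - i" "j - i < ?p" using that by auto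
      then obtain e where e: "of_nat ((j - i) * e) = (1 :: 'a)"
        by (rule inverse_mod_CHAR)
      have "of_nat (j - i) * x = h + - h'"
        using that by (simp add: of_nat_diff algebra_simps)
      then have "of_nat (j - i) * x \<in> H"
        using add neg that by presburger
      from mult[OF this, of e] have "of_nat ((j - i) * e) * x \<in> H"
        by (simp add: mult_ac)
      with e x show False by simp
    qed
    have "inj_on ?f (H \<times> {..<?p})"
    proof (rule inj_onI, clarsimp)
      fix h i h' j assume *: "h \<in> H" "h' \<in> H" "i < ?p" "j < ?p"
        and eq: "h + of_nat i * x = h' + of_nat j * x"
      have "i = j" using no[of h i h' j] no[of h' j h i] * eq
        by (metis linorder_neqE_nat)
      with eq show "h = h' \<and> i = j" by auto
    qed
    then have card: "card H' = card H * ?p"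
      by (simp add: H'_def card_image)
    have "sub H'"
      unfolding sub_def
    proof (intro conjI ballI)
      show "0 \<in> H'" using H p0
        by (auto simp: H'_def sub_def intro!: image_eqI[of _ _ "(0,0)"])
      show "\<exists>k. card H' = ?p ^ k" using card H
        by (auto simp: sub_def intro: exI[of _ "Suc _"])
      fix y z assume "y \<in> H'" "z \<in> H'"
      then obtain h i h' j where yz: "y = h + of_nat i * x" "z = h' + of_nat j * x"
        "h \<in> H" "h' \<in> H" by (auto simp: H'_def)
      have "(of_nat (i + j) :: 'a) = of_nat (?p * ((i + j) div ?p) + (i + j) mod ?p)"
        by simp
      also have "\<dots> = of_nat ((i + j) mod ?p)"
        by (simp only: of_nat_add of_nat_mult of_nat_CHAR) simp
      finally have red: "of_nat ((i + j) mod ?p) = (of_nat i + of_nat j :: 'a)" by simp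
      have "y + z = ?f (h + h', (i + j) mod ?p)"
        by (simp only: split yz red) (simp add: algebra_simps)
      then show "y + z \<in> H'"
        unfolding H'_def by (rule image_eqI) (use add yz p0 in auto)
    qed
    moreover have "card H > 0"
      using H by (auto simp: sub_def card_gt_0_iff)
    ultimately show False
      using max[of H'] card p0 by auto
  qed
  with H show ?thesis by (auto simp: sub_def)
qed

lemma card_field_gt_1: "CARD('a::finite_field) > 1"
  using card_mono[of UNIV "{0, 1 :: 'a}"] by simp

text \<open>Shows that the \<open>THE\<close> in \<open>ext_degree\<close> denotes something: powers
  of a base greater than 1 determine their exponent.\<close>

lemma card_eq_CHAR_power_ext_degree:
  "CARD('a::finite_field) = CHAR('a) ^ ext_degree TYPE('a)"
proof -
  have "CHAR('a) > 1"
    using prime_CHAR_semidom[where ?'a = 'a] CHAR_pos[where ?'a = 'a] prime_gt_1_nat by auto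
  then have "\<exists>!m. CARD('a) = CHAR('a) ^ m"
    using card_finite_field_eq_CHAR_power[where ?'a = 'a] by (auto simp: power_inject_exp)
  from theI'[OF this] show ?thesis unfolding ext_degree_def .
qed

lemma field_trace_0 [simp]: "field_trace 0 = 0"
  by (simp add: field_trace_def zero_power)

text \<open>The trace is a polynomial function of degree \<open>q / p\<close>, so it cannot vanish on all of \<open>F_q\<close>.\<close>

lemma field_trace_nonzero: "\<exists>x :: 'a::finite_field. field_trace x \<noteq> 0"
proof (rule ccontr)
  assume *: "\<not> ?thesis"
  let ?p = "CHAR('a)" and ?m = "ext_degree TYPE('a)"
  have p: "?p > 1"
    using prime_CHAR_semidom[where ?'a = 'a] CHAR_pos[where ?'a = 'a] prime_gt_1_nat by auto
  have m: "?m > 0"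
    using card_field_gt_1[where ?'a = 'a] card_eq_CHAR_power_ext_degree[where ?'a = 'a]
    by (cases "?m") auto
  define P :: "'a poly" where "P = (\<Sum>i<?m. monom 1 (?p ^ i))"
  \<comment> \<open>Only \<open>i = 0\<close> contributes to the linear term, so no cancellation can
    make \<open>P\<close> zero.\<close>
  have "coeff P 1 = (\<Sum>i<?m. if i = 0 then 1 else 0)"
    using p by (auto simp: P_def coeff_sum intro!: sum.cong)
  then have "P \<noteq> 0" using m by auto
  moreover have "poly P x = field_trace x" for x
    by (simp add: P_def field_trace_def poly_sum poly_monom)
  ultimately have "CARD('a) \<le> degree P"
    using card_poly_roots_bound[of P] * by simp
  also have "degree P \<le> ?p ^ (?m - 1)"
    unfolding P_def using p m
    by (intro degree_sum_le) (auto intro!: order.trans[OF degree_monom_le] power_increasing)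
  also have "\<dots> < ?p ^ ?m"
    using p m by (intro power_strict_increasing) auto
  finally show False
    using card_eq_CHAR_power_ext_degree[where ?'a = 'a] by simp
qed

subsection \<open>The symplectic space\<close>

definition padd :: "'a::finite_field vec \<times> 'a vec \<Rightarrow> 'a vec \<times> 'a vec \<Rightarrow> 'a vec \<times> 'a vec" where
  "padd v w = (fst v + fst w, snd v + snd w)"

definition psmult :: "'a::finite_field \<Rightarrow> 'a vec \<times> 'a vec \<Rightarrow> 'a vec \<times> 'a vec" where
  "psmult a v = (a \<cdot>\<^sub>v fst v, a \<cdot>\<^sub>v snd v)"

abbreviation pzero :: "nat \<Rightarrow> 'a::finite_field vec \<times> 'a vec" where
  "pzero n \<equiv> (0\<^sub>v n, 0\<^sub>v n)"

text \<open>The argument of the trace in \<open>trace_symp\<close>. Unlike the trace form it is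
  bilinear over the whole field.\<close>

definition symp_form :: "'a::finite_field vec \<times> 'a vec \<Rightarrow> 'a vec \<times> 'a vec \<Rightarrow> 'a" where
  "symp_form v w = fst w \<bullet> snd v - fst v \<bullet> snd w"

lemma padd_closed [intro]: "v \<in> symp_space n \<Longrightarrow> w \<in> symp_space n \<Longrightarrow> padd v w \<in> symp_space n"
  by (auto simp: symp_space_def padd_def)

lemma psmult_closed [intro]: "v \<in> symp_space n \<Longrightarrow> psmult a v \<in> symp_space n"
  by (auto simp: symp_space_def psmult_def)

lemma pzero_closed [intro, simp]: "pzero n \<in> symp_space n"
  by (auto simp: symp_space_def)

lemma symp_form_padd_left:
  "\<lbrakk>u \<in> symp_space n; v \<in> symp_space n; w \<in> symp_space n\<rbrakk> \<Longrightarrow>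
   symp_form (padd u v) w = symp_form u w + symp_form v w"
  by (auto simp: symp_form_def padd_def symp_space_def add_scalar_prod_distrib[of _ n]
      scalar_prod_add_distrib[of _ n])

lemma symp_form_psmult_left:
  "\<lbrakk>v \<in> symp_space n; w \<in> symp_space n\<rbrakk> \<Longrightarrow> symp_form (psmult a v) w = a * symp_form v w"
  by (auto simp: symp_form_def psmult_def symp_space_def algebra_simps)

lemma symp_form_swap:
  "\<lbrakk>v \<in> symp_space n; w \<in> symp_space n\<rbrakk> \<Longrightarrow> symp_form w v = - symp_form v w"
  by (auto simp: symp_form_def symp_space_def comm_scalar_prod[of _ n])

lemma symp_form_self: "v \<in> symp_space n \<Longrightarrow> symp_form v v = 0"
  by (auto simp: symp_form_def symp_space_def)

lemma symp_form_pzero [simp]: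
  "v \<in> symp_space n \<Longrightarrow> symp_form (pzero n) v = 0"
  "v \<in> symp_space n \<Longrightarrow> symp_form v (pzero n) = 0"
  by (auto simp: symp_form_def symp_space_def)

lemma symp_form_padd_right:
  "\<lbrakk>u \<in> symp_space n; v \<in> symp_space n; w \<in> symp_space n\<rbrakk> \<Longrightarrow>
   symp_form w (padd u v) = symp_form w u + symp_form w v"
  by (simp add: symp_form_swap[of _ n w] padd_closed symp_form_padd_left)

lemma symp_form_psmult_right:
  "\<lbrakk>v \<in> symp_space n; w \<in> symp_space n\<rbrakk> \<Longrightarrow> symp_form w (psmult a v) = a * symp_form w v"
  by (simp add: symp_form_swap[of _ n w] psmult_closed symp_form_psmult_left)

text \<open>A nonzero coordinate in one half is detected by a unit vector in the other half.\<close>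

lemma symp_form_nondegenerate:
  assumes "v \<in> symp_space n" "v \<noteq> pzero n"
  shows "\<exists>w\<in>symp_space n. symp_form w v \<noteq> 0"
proof -
  obtain x y where v: "v = (x, y)" "x \<in> carrier_vec n" "y \<in> carrier_vec n"
    using assms by (auto simp: symp_space_def)
  then obtain i where i: "i < n" "x $ i \<noteq> 0 \<or> y $ i \<noteq> 0"
    using assms by (auto simp: vec_eq_iff)
  from i(2) show ?thesis
  proof
    assume "x $ i \<noteq> 0"
    then show ?thesis using v i
      by (intro bexI[of _ "(0\<^sub>v n, unit_vec n i)"]) (auto simp: symp_form_def symp_space_def)
  next
    assume "y $ i \<noteq> 0"
    then show ?thesis using v i
      by (intro bexI[of _ "(unit_vec n i, 0\<^sub>v n)"]) (auto simp: symp_form_def symp_space_def)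
  qed
qed

lemma card_carrier_vec: "card (carrier_vec n :: 'a::finite vec set) = CARD('a) ^ n"
proof -
  let ?L = "{xs :: 'a list. set xs \<subseteq> UNIV \<and> length xs = n}"
  have "x \<in> vec_of_list ` ?L" if "x \<in> carrier_vec n" for x :: "'a vec"
    using that by (intro image_eqI[of _ _ "list_of_vec x"]) (auto simp: vec_list)
  then have "carrier_vec n = vec_of_list ` ?L"
    by (auto intro!: carrier_vecI)
  moreover have "inj_on vec_of_list ?L"
    by (rule inj_on_inverseI[of _ list_of_vec]) (simp add: list_vec)
  ultimately show ?thesis
    using card_lists_length_eq[of "UNIV :: 'a set" n] by (simp add: card_image)
qed

lemma card_symp_space: "card (symp_space n :: ('a::finite_field vec \<times> 'a vec) set) = CARD('a) ^ (2 * n)"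
  by (simp add: symp_space_def card_cartesian_product card_carrier_vec power_add mult_2)

lemma finite_symp_space [simp]: "finite (symp_space n :: ('a::finite_field vec \<times> 'a vec) set)"
  by (rule card_ge_0_finite) (simp add: card_symp_space)

subsection \<open>Linear codes\<close>

text \<open>Inversion in the product group is multiplication by -1, so closure under inverses is
  absorbed into closure under scalars.\<close>

lemma linear_code_iff:
  "linear_code n C \<longleftrightarrow> C \<subseteq> symp_space n \<and> pzero n \<in> C \<and>
     (\<forall>v\<in>C. \<forall>w\<in>C. padd v w \<in> C) \<and> (\<forall>a. \<forall>v\<in>C. psmult a v \<in> C)"
  (is "_ \<longleftrightarrow> ?R")
proof -
  let ?M = "monoid_vec TYPE('a) n"
  let ?G = "?M \<times>\<times> ?M"
  have gM: "group ?M" using comm_group_vec comm_group_def by blast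
  have inv: "inv\<^bsub>?G\<^esub> v = psmult (-1) v" if "v \<in> symp_space n" for v
  proof -
    have "inv\<^bsub>?M\<^esub> x = (-1) \<cdot>\<^sub>v x" if "x \<in> carrier_vec n" for x
      by (rule group.inv_equality[OF gM]) (use that in \<open>auto simp: monoid_vec_simps\<close>)
    then show ?thesis using that
      by (cases v) (auto simp: inv_DirProd[OF gM gM] psmult_def symp_space_def monoid_vec_simps)
  qed
  have "additive_code n C \<longleftrightarrow> C \<subseteq> symp_space n \<and> pzero n \<in> C \<and>
     (\<forall>v\<in>C. \<forall>w\<in>C. padd v w \<in> C) \<and> (\<forall>v\<in>C. inv\<^bsub>?G\<^esub> v \<in> C)"
    unfolding additive_code_def subgroup_def
    by (simp add: monoid_vec_simps symp_space_def padd_def mult_DirProd' Ball_def) blast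
  moreover have "(\<forall>v\<in>C. inv\<^bsub>?G\<^esub> v \<in> C) \<longleftrightarrow> (\<forall>v\<in>C. psmult (-1) v \<in> C)"
    if "C \<subseteq> symp_space n"
    using inv that by (metis subsetD)
  ultimately show ?thesis
    unfolding linear_code_def by (auto simp: psmult_def case_prod_beta)
qed

lemma linear_code_subset: "linear_code n C \<Longrightarrow> C \<subseteq> symp_space n"
  and linear_code_pzero: "linear_code n C \<Longrightarrow> pzero n \<in> C"
  and linear_code_padd: "linear_code n C \<Longrightarrow> v \<in> C \<Longrightarrow> w \<in> C \<Longrightarrow> padd v w \<in> C"
  and linear_code_psmult: "linear_code n C \<Longrightarrow> v \<in> C \<Longrightarrow> psmult a v \<in> C"
  by (auto simp: linear_code_iff)

lemma linear_code_finite: "linear_code n C \<Longrightarrow> finite C"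
  by (rule finite_subset[OF linear_code_subset finite_symp_space])

lemma linear_code_symp_space: "linear_code n (symp_space n)"
  by (auto simp: linear_code_iff)

lemma linear_code_singleton: "linear_code n {pzero n}"
  by (auto simp: linear_code_iff padd_def psmult_def)

section \<open>Extending a code by one vector\<close>

definition adjoin where
  "adjoin C u = {padd c (psmult a u) | c a. c \<in> C}"

lemma adjoinI: "c \<in> C \<Longrightarrow> padd c (psmult a u) \<in> adjoin C u"
  unfolding adjoin_def by blast

lemma adjoinE:
  assumes "v \<in> adjoin C u"
  obtains c a where "c \<in> C" "v = padd c (psmult a u)"
  using assms unfolding adjoin_def by blast

lemma padd_psmult_cancel:
  assumes "c \<in> symp_space n" "c' \<in> symp_space n" "u \<in> symp_space n"
    and "padd c (psmult a u) = padd c' (psmult b u)"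
  shows "psmult (b - a) u = padd c (psmult (-1) c')"
proof -
  have *: "(b - a) \<cdot>\<^sub>v z = x + (-1) \<cdot>\<^sub>v x'"
    if "x + a \<cdot>\<^sub>v z = x' + b \<cdot>\<^sub>v z" "x \<in> carrier_vec n" "x' \<in> carrier_vec n" "z \<in> carrier_vec n"
    for x x' z :: "'a vec"
  proof (rule eq_vecI)
    fix i assume "i < dim_vec (x + (-1) \<cdot>\<^sub>v x')"
    then have i: "i < n" using that by auto
    then have "x $ i + a * z $ i = x' $ i + b * z $ i"
      using arg_cong[OF that(1), of "\<lambda>v. v $ i"] that(2-4) by simp
    then show "((b - a) \<cdot>\<^sub>v z) $ i = (x + (-1) \<cdot>\<^sub>v x') $ i"
      using i that by (auto simp: algebra_simps)
  qed (use that in auto)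
  show ?thesis
    using assms *[of "fst c" "fst u" "fst c'"] *[of "snd c" "snd u" "snd c'"]
    by (auto simp: padd_def psmult_def symp_space_def)
qed

lemma psmult_psmult: "psmult a (psmult b v) = psmult (a * b) v"
  by (auto simp: psmult_def smult_smult_assoc)

lemma psmult_one [simp]: "psmult 1 v = v"
  by (auto simp: psmult_def)

lemma linear_code_adjoin:
  assumes C: "linear_code n C" and u: "u \<in> symp_space n"
  shows "linear_code n (adjoin C u)"
  unfolding linear_code_iff
proof (intro conjI ballI allI subsetI)
  note sub = linear_code_subset[OF C]
  show "v \<in> symp_space n" if "v \<in> adjoin C u" for v
    using that sub u by (auto elim!: adjoinE)
  have "pzero n = padd (pzero n) (psmult 0 u)"
    using u by (auto simp: padd_def psmult_def symp_space_def)
  then show "pzero n \<in> adjoin C u"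
    using linear_code_pzero[OF C] adjoinI by metis
  show "padd v w \<in> adjoin C u" if v: "v \<in> adjoin C u" and w: "w \<in> adjoin C u" for v w
  proof -
    from v obtain c a where v: "v = padd c (psmult a u)" "c \<in> C" by (rule adjoinE)
    from w obtain c' a' where w: "w = padd c' (psmult a' u)" "c' \<in> C" by (rule adjoinE)
    have "c \<in> symp_space n" "c' \<in> symp_space n" using v w sub by auto
    then have "padd v w = padd (padd c c') (psmult (a + a') u)"
      using v w u by (auto simp: padd_def psmult_def symp_space_def vec_eq_iff algebra_simps)
    then show ?thesis using linear_code_padd[OF C] v w by (simp add: adjoinI)
  qed
  show "psmult b v \<in> adjoin C u" if v: "v \<in> adjoin C u" for v b
  proof -
    from v obtain c a where v: "v = padd c (psmult a u)" "c \<in> C" by (rule adjoinE)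
    have "c \<in> symp_space n" using v sub by auto
    then have "psmult b v = padd (psmult b c) (psmult (b * a) u)"
      using v u by (auto simp: padd_def psmult_def symp_space_def vec_eq_iff algebra_simps)
    then show ?thesis using linear_code_psmult[OF C] v by (simp add: adjoinI)
  qed
qed

lemma adjoin_superset: "linear_code n C \<Longrightarrow> u \<in> symp_space n \<Longrightarrow> C \<subseteq> adjoin C u"
proof
  fix c assume *: "linear_code n C" "u \<in> symp_space n" "c \<in> C"
  then have "c = padd c (psmult 0 u)"
    using linear_code_subset[of n C] by (auto simp: padd_def psmult_def symp_space_def vec_eq_iff)
  then show "c \<in> adjoin C u" using * adjoinI by metis
qed

text \<open>The pair \<open>(c, a)\<close> is determined by the vector \<open>c + a u\<close>: two
  values of \<open>a\<close> would force a nonzero multiple of \<open>u\<close>, and hence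
  \<open>u\<close>, into \<open>C\<close>.\<close>

lemma card_adjoin:
  fixes u :: "'a::finite_field vec \<times> 'a vec"
  assumes C: "linear_code n C" and u: "u \<in> symp_space n" and "u \<notin> C"
  shows "card (adjoin C u) = CARD('a) * card C"
proof -
  let ?f = "\<lambda>(c, a). padd c (psmult a u)"
  have key: "c = c' \<and> a = b"
    if c: "c \<in> C" "c' \<in> C" and eq: "padd c (psmult a u) = padd c' (psmult b u)" for c c' a b
  proof -
    have *: "c \<in> symp_space n" "c' \<in> symp_space n"
      using c linear_code_subset[OF C] by (simp_all add: subsetD)
    from padd_psmult_cancel[OF * u eq] have "psmult (b - a) u \<in> C"
      using c linear_code_padd[OF C] linear_code_psmult[OF C] by simp
    from linear_code_psmult[OF C this, of "inverse (b - a)"] have "a = b"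
      using \<open>u \<notin> C\<close> by (cases "a = b") (auto simp: psmult_psmult)
    with eq * u show ?thesis
      by (auto simp: padd_def psmult_def symp_space_def vec_eq_iff)
  qed
  have "inj_on ?f (C \<times> UNIV)"
  proof (rule inj_onI)
    fix p p' assume "p \<in> C \<times> UNIV" "p' \<in> C \<times> UNIV" "?f p = ?f p'"
    then show "p = p'"
      using key[of "fst p" "fst p'" "snd p" "snd p'"] by (simp add: prod_eq_iff case_prod_beta mem_Times_iff)
  qed
  moreover have "adjoin C u = ?f ` (C \<times> UNIV)" unfolding adjoin_def by force
  ultimately show ?thesis by (simp add: card_image card_cartesian_product)
qed

lemma linear_code_kernel:
  fixes f :: "'a::finite_field vec \<times> 'a vec \<Rightarrow> 'a"
  assumes C: "linear_code n C"
    and add: "\<And>v w. v \<in> C \<Longrightarrow> w \<in> C \<Longrightarrow> f (padd v w) = f v + f w"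
    and smult: "\<And>a v. v \<in> C \<Longrightarrow> f (psmult a v) = a * f v"
  shows "linear_code n {v \<in> C. f v = 0}"
proof -
  have "psmult 0 (pzero n) = pzero n" by (auto simp: psmult_def)
  then have "f (pzero n) = 0" using smult[of "pzero n" 0] linear_code_pzero[OF C] by (metis mult_zero_left)
  then show ?thesis
    using assms by (auto simp: linear_code_iff)
qed

text \<open>Rank and nullity in counting form: \<open>C\<close> is the kernel with the single vector
  \<open>x\<close> adjoined.\<close>

lemma card_linear_functional:
  fixes f :: "'a::finite_field vec \<times> 'a vec \<Rightarrow> 'a"
  assumes C: "linear_code n C"
    and add: "\<And>v w. v \<in> C \<Longrightarrow> w \<in> C \<Longrightarrow> f (padd v w) = f v + f w"
    and smult: "\<And>a v. v \<in> C \<Longrightarrow> f (psmult a v) = a * f v"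
    and x: "x \<in> C" "f x \<noteq> 0"
  shows "card C = CARD('a) * card {v \<in> C. f v = 0}"
proof -
  let ?K = "{v \<in> C. f v = 0}"
  have K: "linear_code n ?K" using linear_code_kernel[of n C f] assms by blast
  have xs: "x \<in> symp_space n" using x linear_code_subset[OF C] by auto
  have "C \<subseteq> adjoin ?K x"
  proof
    fix v assume v: "v \<in> C"
    define a where "a = f v / f x"
    define k where "k = padd v (psmult (- a) x)"
    have "v \<in> symp_space n" using v linear_code_subset[OF C] by auto
    then have "v = padd k (psmult a x)"
      using xs by (auto simp: k_def padd_def psmult_def symp_space_def vec_eq_iff)
    moreover have "k \<in> ?K"
      using v x add smult linear_code_padd[OF C] linear_code_psmult[OF C]
      by (auto simp: k_def a_def)
    ultimately show "v \<in> adjoin ?K x" by (metis adjoinI)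
  qed
  moreover have "adjoin ?K x \<subseteq> C"
    using x linear_code_padd[OF C] linear_code_psmult[OF C] by (metis (no_types, lifting) adjoinE mem_Collect_eq subsetI)
  ultimately show ?thesis
    using card_adjoin[OF K xs] x by auto
qed

subsection \<open>Symplectic duality\<close>

text \<open>A nonzero value of the form can be scaled, inside the linear code, to an element of
  nonzero trace. Hence the trace does not enlarge the dual.\<close>

lemma symp_dual_linear:
  assumes C: "linear_code n C"
  shows "symp_dual n C = {v \<in> symp_space n. \<forall>c\<in>C. symp_form v c = 0}"
proof -
  have ts: "trace_symp v c = field_trace (symp_form v c)" for v c :: "'a vec \<times> 'a vec"
    by (simp add: trace_symp_def symp_form_def)
  have "symp_form v c = 0" if v: "v \<in> symp_dual n C" and c: "c \<in> C" for v c
  proof (rule ccontr)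
    assume nz: "symp_form v c \<noteq> 0"
    obtain t :: 'a where t: "field_trace t \<noteq> 0" using field_trace_nonzero by auto
    let ?a = "t / symp_form v c"
    have "symp_form v (psmult ?a c) = t"
      using v c linear_code_subset[OF C] nz
      by (subst symp_form_psmult_right[of _ n]) (auto simp: symp_dual_def)
    then show False
      using v linear_code_psmult[OF C c, of ?a] t by (auto simp: symp_dual_def ts)
  qed
  then show ?thesis by (auto simp: symp_dual_def ts)
qed

lemma symp_dual_subset: "symp_dual n C \<subseteq> symp_space n"
  by (auto simp: symp_dual_def)

lemma symp_dual_antimono: "C \<subseteq> C' \<Longrightarrow> symp_dual n C' \<subseteq> symp_dual n C"
  by (auto simp: symp_dual_def)

lemma linear_code_symp_dual:
  assumes C: "linear_code n C"
  shows "linear_code n (symp_dual n C)"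
  unfolding linear_code_iff[of n "symp_dual n C"]
  using linear_code_subset[OF C]
  by (simp add: symp_dual_linear[OF C] subset_iff padd_closed psmult_closed
      symp_form_padd_left[of _ n] symp_form_psmult_left[of _ n] del: split_paired_All)

text \<open>Double counting of the orthogonal pairs in \<open>C \<times> F_q^{2n}\<close>: a nonzero linear functional
  vanishes on exactly the fraction \<open>1/q\<close> of a space.\<close>

lemma card_symp_dual:
  fixes C :: "('a::finite_field vec \<times> 'a vec) set"
  assumes C: "linear_code n C"
  shows "card C * card (symp_dual n C) = CARD('a) ^ (2 * n)"
proof -
  let ?V = "symp_space n :: ('a vec \<times> 'a vec) set" and ?q = "CARD('a)"
  let ?D = "symp_dual n C"
  note sub = linear_code_subset[OF C] and fin = linear_code_finite[OF C]
  have D: "?D = {v \<in> ?V. \<forall>c\<in>C. symp_form v c = 0}" by (rule symp_dual_linear[OF C])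
  \<comment> \<open>Both counts carry a factor \<open>?q\<close>, which avoids dividing by
    it.\<close>
  have rows: "?q * card {v \<in> ?V. symp_form v c = 0} = (if c = pzero n then ?q * card ?V else card ?V)"
    if "c \<in> C" for c
  proof (cases "c = pzero n")
    case True
    then show ?thesis by (auto intro!: arg_cong[of _ _ card])
  next
    case False
    have c: "c \<in> ?V" using that sub by (rule rev_subsetD)
    obtain x where x: "x \<in> ?V" "symp_form x c \<noteq> 0"
      using symp_form_nondegenerate[OF c False] by (rule bexE)
    then have "card ?V = ?q * card {v \<in> ?V. symp_form v c = 0}"
      using c x by (intro card_linear_functional[OF linear_code_symp_space, where f = "\<lambda>v. symp_form v c" and x = x])
        (simp_all add: symp_form_padd_left[of _ n] symp_form_psmult_left[of _ n])
    with False show ?thesis by simp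
  qed
  have cols: "?q * card {c \<in> C. symp_form v c = 0} = (if v \<in> ?D then ?q * card C else card C)"
    if "v \<in> ?V" for v
  proof (cases "v \<in> ?D")
    case True
    then have "{c \<in> C. symp_form v c = 0} = C" by (auto simp: D)
    with True show ?thesis by simp
  next
    case False
    with that have "\<exists>x\<in>C. symp_form v x \<noteq> 0" unfolding D by simp
    then obtain x where x: "x \<in> C" "symp_form v x \<noteq> 0" by (rule bexE)
    then have "card C = ?q * card {c \<in> C. symp_form v c = 0}"
      using that sub x by (intro card_linear_functional[OF C, where x = x])
        (simp_all add: symp_form_padd_right[of _ n] symp_form_psmult_right[of _ n] subsetD)
    with False show ?thesis by simp
  qed
  have count: "card {x \<in> A. P x} = (\<Sum>x\<in>A. of_bool (P x))" if "finite A" for A :: "('a vec \<times> 'a vec) set" and P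
    using that by (simp add: of_bool_def sum.If_cases Int_def)
  have "(\<Sum>c\<in>C. ?q * card {v \<in> ?V. symp_form v c = 0}) =
        ?q * (\<Sum>c\<in>C. \<Sum>v\<in>?V. of_bool (symp_form v c = 0))"
    by (simp add: sum_distrib_left count)
  also have "\<dots> = ?q * (\<Sum>v\<in>?V. \<Sum>c\<in>C. of_bool (symp_form v c = 0))"
    by (subst sum.swap) simp
  also have "\<dots> = (\<Sum>v\<in>?V. ?q * card {c \<in> C. symp_form v c = 0})"
    by (simp add: sum_distrib_left count fin)
  finally have "(\<Sum>c\<in>C. if c = pzero n then ?q * card ?V else card ?V) =
                (\<Sum>v\<in>?V. if v \<in> ?D then ?q * card C else card C)"
    using rows cols by (simp cong: sum.cong)
  moreover have "C \<inter> {c. c = pzero n} = {pzero n}" using linear_code_pzero[OF C] by auto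
  moreover have "C \<inter> - {c. c = pzero n} = C - {pzero n}" by auto
  moreover have "?V \<inter> ?D = ?D" "?V \<inter> - ?D = ?V - ?D" using symp_dual_subset by auto
  ultimately have eq: "?q * card ?V + (card C - 1) * card ?V =
      card ?D * (?q * card C) + (card ?V - card ?D) * card C"
    using fin linear_code_pzero[OF C] symp_dual_subset[of n C]
    by (simp add: sum.If_cases card_Diff_subset finite_subset[OF symp_dual_subset])
  have "card C \<ge> 1" using fin linear_code_pzero[OF C]
    by (metis One_nat_def Suc_leI card_gt_0_iff empty_iff)
  moreover have "card ?D \<le> card ?V" by (intro card_mono symp_dual_subset) simp
  \<comment> \<open>The substitutions remove truncated subtraction. Then
    \<open>card C * card ?V\<close> cancels from both sides of \<open>eq\<close>, leaving the common
    factor \<open>?q - 1\<close>.\<close>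
  ultimately obtain c e where "card C = c + 1" "card ?V = card ?D + e"
    by (metis add.commute le_Suc_ex)
  with eq have "(?q - 1) * card ?V = (?q - 1) * (card C * card ?D)"
    using card_field_gt_1[where ?'a = 'a] by (cases "?q") (auto simp: algebra_simps)
  then show ?thesis
    using card_field_gt_1[where ?'a = 'a] by (simp add: card_symp_space)
qed

text \<open>One inclusion follows from antisymmetry of the form; equality follows because two uses
  of \<open>card_symp_dual\<close> give equal cardinalities.\<close>

lemma symp_dual_symp_dual:
  assumes C: "linear_code n C"
  shows "symp_dual n (symp_dual n C) = C"
proof -
  let ?D = "symp_dual n C"
  have D: "linear_code n ?D" by (rule linear_code_symp_dual[OF C])
  have "card C * card ?D = card (symp_dual n ?D) * card ?D"
    using card_symp_dual[OF C] card_symp_dual[OF D] by (simp add: mult.commute)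
  moreover have "card ?D \<noteq> 0"
    using linear_code_finite[OF D] linear_code_pzero[OF D] by auto
  moreover have "C \<subseteq> symp_dual n ?D"
  proof
    fix c assume c: "c \<in> C"
    have "symp_form c d = 0" if "d \<in> ?D" for d
      using that c linear_code_subset[OF C] symp_form_swap[of d n c]
      by (auto simp: symp_dual_linear[OF C])
    then show "c \<in> symp_dual n ?D"
      using c linear_code_subset[OF C] by (auto simp: symp_dual_linear[OF D])
  qed
  ultimately show ?thesis
    using linear_code_finite[OF linear_code_symp_dual[OF D]] by (metis card_subset_eq mult_cancel2)
qed

subsection \<open>Subsystem codes from self-orthogonal codes\<close>

lemma swt_le_card:
  assumes "v \<in> symp_space n" "finite S"
    and "\<And>i. i < n \<Longrightarrow> i \<notin> S \<Longrightarrow> fst v $ i = 0 \<and> snd v $ i = 0"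
  shows "swt v \<le> card S"
  unfolding swt_def
proof (intro card_mono assms(2) subsetI, rule ccontr)
  fix i assume "i \<in> {i. i < dim_vec (fst v) \<and> (fst v $ i, snd v $ i) \<noteq> (0, 0)}" "i \<notin> S"
  then show False using assms(1) assms(3)[of i] by (auto simp: symp_space_def)
qed

lemma psmult_minus_add:
  assumes "v \<in> symp_space n" "w \<in> symp_space n"
  shows "padd (padd v (psmult (-1) w)) w = v"
  using assms by (auto simp: padd_def psmult_def symp_space_def vec_eq_iff)

text \<open>\<open>E\<close> is an MDS code over the alphabet \<open>F_q^2\<close>: its first \<open>n - m\<close> coordinates form an
  information set, so it is generated by words of minimum weight.\<close>

lemma minimum_weight_words_generate:
  fixes E :: "('a::finite_field vec \<times> 'a vec) set"
  assumes E: "linear_code n E" and card: "card E = CARD('a) ^ (2 * (n - m))"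
    and "m < n" and min: "\<And>v. v \<in> E \<Longrightarrow> v \<noteq> pzero n \<Longrightarrow> m + 1 \<le> swt v"
    and C: "linear_code n C" and EC: "\<And>v. v \<in> E \<Longrightarrow> swt v \<le> m + 1 \<Longrightarrow> v \<in> C"
  shows "E \<subseteq> C"
proof -
  define \<pi> :: "'a vec \<times> 'a vec \<Rightarrow> 'a vec \<times> 'a vec" where
    "\<pi> v = (vec (n - m) (\<lambda>i. fst v $ i), vec (n - m) (\<lambda>i. snd v $ i))" for v
  have Es: "v \<in> symp_space n" if "v \<in> E" for v
    using linear_code_subset[OF E] that by (rule subsetD)
  have diff: "padd v (psmult (-1) w) \<in> E" if "v \<in> E" "w \<in> E" for v w
    using that linear_code_padd[OF E] linear_code_psmult[OF E] by simp
  have diff_nth: "fst (padd v (psmult (-1) w)) $ i = fst v $ i - fst w $ i"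
    "snd (padd v (psmult (-1) w)) $ i = snd v $ i - snd w $ i"
    if "v \<in> symp_space n" "w \<in> symp_space n" "i < n" for v w :: "'a vec \<times> 'a vec" and i
    using that by (auto simp: padd_def psmult_def symp_space_def)
  have "inj_on \<pi> E"
  proof (rule inj_onI)
    fix v w assume vw: "v \<in> E" "w \<in> E" "\<pi> v = \<pi> w"
    let ?u = "padd v (psmult (-1) w)"
    \<comment> \<open>Words that agree on the first \<open>n - m\<close> coordinates differ in at
      most \<open>m\<close> places, too few for a nonzero word of \<open>E\<close>.\<close>
    have "swt ?u \<le> card {n-m..<n}"
    proof (rule swt_le_card)
      fix i assume i: "i < n" "i \<notin> {n-m..<n}"
      with vw(3) have "fst v $ i = fst w $ i" "snd v $ i = snd w $ i"
        by (auto simp: \<pi>_def vec_eq_iff)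
      then show "fst ?u $ i = 0 \<and> snd ?u $ i = 0"
        using diff_nth[of v w i] Es vw i by simp
    qed (use Es diff vw in auto)
    then have "?u = pzero n"
      using min[OF diff[OF vw(1,2)]] \<open>m < n\<close> by fastforce
    then have "padd (pzero n) w = v"
      using psmult_minus_add[of v n w] Es vw by simp
    also have "padd (pzero n) w = w"
      using Es[OF vw(2)] by (cases w) (auto simp: padd_def symp_space_def)
    finally show "v = w" ..
  qed
  then have "card (\<pi> ` E) = card (symp_space (n - m) :: ('a vec \<times> 'a vec) set)"
    by (simp add: card_image card card_symp_space)
  moreover have "\<pi> ` E \<subseteq> symp_space (n - m)"
    by (auto simp: \<pi>_def symp_space_def)
  ultimately have surj: "\<pi> ` E = symp_space (n - m)"
    by (intro card_subset_eq) auto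
  \<comment> \<open>The induction clears the information set from the right: \<open>w\<close> may be
    nonzero there only before position \<open>j\<close>.\<close>
  have "j \<le> n - m \<Longrightarrow> w \<in> E \<Longrightarrow>
      (\<And>i. j \<le> i \<Longrightarrow> i < n - m \<Longrightarrow> fst w $ i = 0 \<and> snd w $ i = 0) \<Longrightarrow> w \<in> C" for j w
  proof (induction j arbitrary: w)
    case 0
    have "swt w \<le> card {n-m..<n}"
      using 0 Es by (intro swt_le_card[of w n]) auto
    then show ?case using EC 0 \<open>m < n\<close> by simp
  next
    case (Suc j)
    let ?e = "(vec (n - m) (\<lambda>i. if i = j then fst w $ i else 0),
               vec (n - m) (\<lambda>i. if i = j then snd w $ i else 0))"
    have "?e \<in> \<pi> ` E" unfolding surj by (auto simp: symp_space_def)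
    \<comment> \<open>\<open>e\<close> agrees with \<open>w\<close> at position \<open>j\<close> and
      vanishes on the rest of the information set. Its weight is at most \<open>m + 1\<close>, and
      subtracting it from \<open>w\<close> clears position \<open>j\<close>.\<close>
    then obtain e where e: "?e = \<pi> e" "e \<in> E" by (rule imageE)
    have en: "fst e $ i = (if i = j then fst w $ i else 0)"
      "snd e $ i = (if i = j then snd w $ i else 0)" if "i < n - m" for i
      using e(1) that by (auto simp: \<pi>_def vec_eq_iff)
    have "swt e \<le> card (insert j {n-m..<n})"
      using en Es e by (intro swt_le_card[of e n]) auto
    also have "\<dots> \<le> m + 1"
      using card_insert_le_m1[of "m + 1" "{n-m..<n}" j] \<open>m < n\<close> by simp
    finally have "e \<in> C" using EC e by simp
    have "padd w (psmult (-1) e) \<in> C"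
    proof (rule Suc.IH)
      fix i assume i: "j \<le> i" "i < n - m"
      have "i < n" using i by simp
      moreover have "Suc j \<le> i" if "i \<noteq> j" using i that by simp
      ultimately show "fst (padd w (psmult (-1) e)) $ i = 0 \<and> snd (padd w (psmult (-1) e)) $ i = 0"
        using Suc.prems(3)[of i] en[of i] diff_nth[of w e i] Es Suc.prems e i
        by (cases "i = j") simp_all
    qed (use Suc.prems diff e in auto)
    from linear_code_padd[OF C this \<open>e \<in> C\<close>] show ?case
      using psmult_minus_add[of w n e] Es Suc.prems e by simp
  qed
  from this[of "n - m"] show ?thesis by auto
qed

text \<open>Each step adjoins a hyperbolic pair \<open>u\<close>, \<open>w\<close> from \<open>C\<^sup>\<perp>\<close>, which leaves the radical unchanged.\<close>

lemma extend_with_radical: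
  fixes D :: "('a::finite_field vec \<times> 'a vec) set"
  assumes D: "linear_code n D" and DD: "D \<subseteq> symp_dual n D"
    and card: "card D = CARD('a) ^ (2 * m)" and "2 * m + r \<le> n"
  shows "\<exists>C. linear_code n C \<and> D \<subseteq> C \<and> C \<subseteq> symp_dual n D \<and> C \<inter> symp_dual n C = D \<and>
    card C = CARD('a) ^ (2 * m + 2 * r)"
  using \<open>2 * m + r \<le> n\<close>
proof (induction r)
  case 0
  then show ?case using assms by (intro exI[of _ D]) auto
next
  case (Suc r)
  then obtain C where C: "linear_code n C" and DC: "D \<subseteq> C" and CD: "C \<subseteq> symp_dual n D"
    and rad: "C \<inter> symp_dual n C = D" and cC: "card C = CARD('a) ^ (2 * m + 2 * r)"
    by auto
  let ?P = "symp_dual n C" and ?q = "CARD('a)"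
  have q: "?q > 1" by (rule card_field_gt_1)
  have P: "linear_code n ?P" by (rule linear_code_symp_dual[OF C])
  have Pdef: "?P = {v \<in> symp_space n. \<forall>c\<in>C. symp_form v c = 0}" by (rule symp_dual_linear[OF C])
  have Cs: "v \<in> symp_space n" if "v \<in> C" for v using linear_code_subset[OF C] that by (rule subsetD)
  have Ps: "v \<in> symp_space n" if "v \<in> ?P" for v using symp_dual_subset that by (rule subsetD)
  have "card C * card ?P = ?q ^ (2 * m + 2 * r) * ?q ^ (2 * n - 2 * m - 2 * r)"
    using card_symp_dual[OF C] Suc.prems by (simp flip: power_add)
  then have "card ?P = ?q ^ (2 * n - 2 * m - 2 * r)"
    using cC q by simp
  \<comment> \<open>The room for one more pair: \<open>2 * m + Suc r \<le> n\<close> makes the dual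
    of \<open>C\<close> strictly larger than \<open>D\<close>.\<close>
  moreover have "?q ^ (2 * m) < ?q ^ (2 * n - 2 * m - 2 * r)"
    using Suc.prems q by (intro power_strict_increasing) auto
  ultimately have "\<not> ?P \<subseteq> D"
    using card card_mono[OF linear_code_finite[OF D], of ?P] by auto
  then obtain u where u: "u \<in> ?P" "u \<notin> D" by (auto simp only: subset_iff)
  have uC: "u \<notin> C" using u rad by blast
  \<comment> \<open>Since \<open>C\<close> is the dual of \<open>?P\<close>, a vector of
    \<open>?P\<close> outside \<open>C\<close> has a partner in \<open>?P\<close> with nonzero
    product.\<close>
  then have "u \<notin> symp_dual n ?P" by (simp add: symp_dual_symp_dual[OF C])
  then have "\<exists>w\<in>?P. symp_form u w \<noteq> 0"
    using Ps[OF u(1)] by (simp add: symp_dual_linear[OF P])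
  then obtain w where w: "w \<in> ?P" "symp_form u w \<noteq> 0" by (rule bexE)
  note us = Ps[OF u(1)] and ws = Ps[OF w(1)]
  let ?C1 = "adjoin C u"
  let ?C2 = "adjoin ?C1 w"
  have C1: "linear_code n ?C1" by (rule linear_code_adjoin[OF C us])
  have C2: "linear_code n ?C2" by (rule linear_code_adjoin[OF C1 ws])
  have orth: "symp_form u c = 0" "symp_form w c = 0" "symp_form c u = 0" "symp_form c w = 0"
    if "c \<in> C" for c
    using that u w symp_form_swap[OF us Cs[OF that]] symp_form_swap[OF ws Cs[OF that]]
    by (simp_all add: Pdef)
  \<comment> \<open>Pairing with \<open>u\<close> and \<open>w\<close> reads off the two new
    coefficients, so both vanish for a vector of the radical.\<close>
  have form: "symp_form u (padd (padd c (psmult a u)) (psmult b w)) = b * symp_form u w"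
     "symp_form w (padd (padd c (psmult a u)) (psmult b w)) = - a * symp_form u w"
    if "c \<in> C" for c a b
    using Cs[OF that] us ws orth[OF that] symp_form_swap[OF us ws]
    by (simp_all add: symp_form_padd_right[of _ n] symp_form_psmult_right[of _ n] padd_closed
        psmult_closed symp_form_self[of _ n])
  have "w \<notin> ?C1"
  proof
    assume "w \<in> ?C1"
    then obtain c a where "c \<in> C" "w = padd c (psmult a u)" by (rule adjoinE)
    then have "symp_form u w = 0"
      using Cs us orth by (simp add: symp_form_padd_right[of _ n] symp_form_psmult_right[of _ n]
          psmult_closed symp_form_self[of _ n])
    with w show False by simp
  qed
  then have c2: "card ?C2 = ?q ^ (2 * m + 2 * Suc r)"
    using card_adjoin[OF C1 ws] card_adjoin[OF C us uC] cC by simp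
  have sub: "C \<subseteq> ?C2"
    using adjoin_superset[OF C us] adjoin_superset[OF C1 ws] by (rule order.trans)
  have inC2: "padd (padd c (psmult a u)) (psmult b w) \<in> ?C2" if "c \<in> C" for c a b
    using that by (intro adjoinI)
  have elim: "\<exists>c\<in>C. \<exists>a b. v = padd (padd c (psmult a u)) (psmult b w)" if "v \<in> ?C2" for v
    using that by (elim adjoinE) blast
  have PD: "?P \<subseteq> symp_dual n D" by (rule symp_dual_antimono[OF DC])
  have dual: "linear_code n (symp_dual n D)" by (rule linear_code_symp_dual[OF D])
  have "?C2 \<subseteq> symp_dual n D"
  proof
    fix v assume "v \<in> ?C2"
    from elim[OF this] obtain c a b where "c \<in> C" "v = padd (padd c (psmult a u)) (psmult b w)"
      by (elim bexE exE)
    then show "v \<in> symp_dual n D"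
      using subsetD[OF CD] subsetD[OF PD] u w
      by (simp add: linear_code_padd[OF dual] linear_code_psmult[OF dual])
  qed
  moreover have "?C2 \<inter> symp_dual n ?C2 = D"
  proof (intro equalityI subsetI IntI)
    fix v assume v: "v \<in> ?C2 \<inter> symp_dual n ?C2"
    then have "v \<in> ?C2" by simp
    from elim[OF this] obtain c a b
      where c: "c \<in> C" and v_eq: "v = padd (padd c (psmult a u)) (psmult b w)"
      by (elim bexE exE)
    have "u \<in> ?C2"
      using adjoinI[OF linear_code_pzero[OF C], of 1 u] adjoin_superset[OF C1 ws] us
      by (auto simp: padd_def symp_space_def)
    moreover have "w \<in> ?C2"
      using adjoinI[OF linear_code_pzero[OF C1], of 1 w] ws
      by (auto simp: padd_def symp_space_def)
    moreover have vs: "v \<in> symp_space n" using v symp_dual_subset by auto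
    ultimately have "symp_form v u = 0" "symp_form v w = 0"
      using v by (simp_all add: symp_dual_linear[OF C2])
    then have "a = 0" "b = 0"
      using form[OF c, of a b] w symp_form_swap[OF vs us] symp_form_swap[OF vs ws] v_eq by simp_all
    then have "v = c"
      using v_eq Cs[OF c] us ws by (auto simp: padd_def psmult_def symp_space_def vec_eq_iff)
    then show "v \<in> D"
      using c v symp_dual_antimono[OF sub] rad by auto
  next
    fix v assume v: "v \<in> D"
    then have vC: "v \<in> C" using DC by auto
    then show "v \<in> ?C2" using sub by auto
    \<comment> \<open>\<open>D\<close> equals its double dual, and \<open>?C2\<close> lies in the
      dual of \<open>D\<close>.\<close>
    show "v \<in> symp_dual n ?C2"
      using v \<open>?C2 \<subseteq> symp_dual n D\<close> D
      by (metis C2 linear_code_symp_dual subsetD symp_dual_antimono symp_dual_symp_dual)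
  qed
  ultimately show ?case
    using C2 c2 sub DC by (intro exI[of _ ?C2]) auto
qed

lemma linear_MDS_from_self_orthogonal:
  fixes D :: "('a::finite_field vec \<times> 'a vec) set"
  assumes D: "linear_code n D" and DD: "D \<subseteq> symp_dual n D"
    and card: "card D = CARD('a) ^ (2 * m)" and "m < n" and r: "2 * m + r \<le> n"
    and min: "\<And>v. v \<in> symp_dual n D \<Longrightarrow> v \<noteq> pzero n \<Longrightarrow> m + 1 \<le> swt v"
  shows "\<exists>C :: ('a vec \<times> 'a vec) set. linear_MDS C n (n - 2 * m - r) r (m + 1) \<and> pure_to n (m + 1) C"
proof -
  obtain C where C: "linear_code n C" and DC: "D \<subseteq> C" and CD: "C \<subseteq> symp_dual n D"
    and rad: "C \<inter> symp_dual n C = D" and cC: "card C = CARD('a) ^ (2 * m + 2 * r)"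
    using extend_with_radical[OF D DD card r] by auto
  let ?E = "symp_dual n D" and ?q = "CARD('a)"
  have q: "?q > 1" by (rule card_field_gt_1)
  have E: "linear_code n ?E" by (rule linear_code_symp_dual[OF D])
  have "card D * card ?E = ?q ^ (2 * m) * ?q ^ (2 * (n - m))"
    using card_symp_dual[OF D] \<open>m < n\<close> by (simp flip: power_add distrib_left)
  then have cE: "card ?E = ?q ^ (2 * (n - m))"
    using card q by simp
  \<comment> \<open>Covers both cases in the definition of the distance: \<open>B\<close> is
    \<open>C\<close> when \<open>?E\<close> is larger than \<open>C\<close>, and the zero code when
    they coincide.\<close>
  have exact: "\<exists>v\<in>?E - B. v \<noteq> pzero n \<and> swt v = m + 1"
    if B: "linear_code n B" "\<not> ?E \<subseteq> B" for B
  proof -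
    have "\<exists>v\<in>?E. swt v \<le> m + 1 \<and> v \<notin> B"
      using minimum_weight_words_generate[OF E cE \<open>m < n\<close> min B(1)] B(2) by metis
    then obtain v where v: "v \<in> ?E" "swt v \<le> m + 1" "v \<notin> B" by (elim bexE conjE)
    have "v \<noteq> pzero n" using v linear_code_pzero[OF B(1)] by metis
    with v min[OF v(1)] show ?thesis by (intro bexI[of _ v]) auto
  qed
  have min_swt: "min_swt n S = m + 1"
    if "S \<subseteq> ?E" "v \<in> S" "v \<noteq> pzero n" "swt v = m + 1" for S v
    unfolding min_swt_def
  proof (rule Min_eqI)
    show "finite (swt ` (S - {pzero n}))"
      using that(1) linear_code_finite[OF E] finite_subset by blast
    show "m + 1 \<in> swt ` (S - {pzero n})"
      using that by (intro image_eqI[of _ _ v]) auto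
  qed (use min that(1) in blast)
  have "m + 1 = (if ?E \<noteq> C then min_swt n (?E - C) else min_swt n ?E)"
  proof (cases "?E = C")
    case True
    have "card ?E > 1" using cE one_less_power[OF q, of "2 * (n - m)"] \<open>m < n\<close> by simp
    then have "\<not> ?E \<subseteq> {pzero n}"
      using card_mono[of "{pzero n}" ?E] by auto
    from exact[OF linear_code_singleton this] obtain v where "v \<in> ?E" "v \<noteq> pzero n" "swt v = m + 1"
      by (elim bexE conjE DiffE)
    with True show ?thesis using min_swt[of ?E v] by simp
  next
    case False
    with CD have "\<not> ?E \<subseteq> C" by blast
    from exact[OF C this] obtain v where "v \<in> ?E - C" "v \<noteq> pzero n" "swt v = m + 1"
      by (elim bexE conjE)
    with False show ?thesis using min_swt[of "?E - C" v] by simp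
  qed
  moreover have "real (card C) = real ?q ^ n * real (?q ^ r) / real (?q ^ (n - 2 * m - r))"
  proof -
    have "real ?q ^ (2 * m + 2 * r) * real ?q ^ (n - 2 * m - r) = real ?q ^ n * real ?q ^ r"
      using r by (simp add: add.commute flip: power_add)
    then show ?thesis using cC q by (simp add: field_simps)
  qed
  moreover have "real (card D) = real ?q ^ n / (real (?q ^ (n - 2 * m - r)) * real (?q ^ r))"
  proof -
    have "real ?q ^ (2 * m) * (real ?q ^ (n - 2 * m - r) * real ?q ^ r) = real ?q ^ n"
      using r by (simp flip: power_add)
    then show ?thesis using card q by (simp add: field_simps)
  qed
  ultimately have "subsystem_code_log C n (n - 2 * m - r) r (m + 1)"
    using C rad by (simp add: subsystem_code_log_def subsystem_code_def Let_def linear_code_def)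
  then have "linear_MDS C n (n - 2 * m - r) r (m + 1)"
    using C r by (simp add: linear_MDS_def)
  moreover have "pure_to n (m + 1) C"
    using min CD by (auto simp: pure_to_def)
  ultimately show ?thesis by blast
qed

subsection \<open>The quadratic extension field\<close>

text \<open>Sending two roots to the coefficients of their quadratic is symmetric, hence not
  injective, hence not surjective on a finite set. A missed pair of coefficients has no root, since
  a root \<open>x\<close> would come with the second root \<open>s - x\<close>.\<close>

lemma irreducible_quadratic_exists:
  "\<exists>p :: 'a::finite_field \<times> 'a. \<forall>x. x * x \<noteq> fst p * x + snd p"
proof -
  let ?f = "\<lambda>(a, b). (a + b, - (a * b)) :: 'a \<times> 'a"
  have "\<not> inj ?f"
    by (auto dest: injD[of _ "(0, 1)" "(1, 0)"])
  then have "\<not> surj ?f"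
    using finite_UNIV_surj_inj[of ?f] by auto
  then obtain p where p: "p \<notin> range ?f" by blast
  obtain s t where "p = (s, t)" by (rule prod.exhaust)
  with p have st: "(s, t) \<noteq> (a + b, - (a * b))" for a b
    using rangeI[of ?f "(a, b)"] by auto
  have "x * x \<noteq> s * x + t" for x
    using st[of x "s - x"] by (auto simp: algebra_simps)
  then show ?thesis by (intro exI[of _ "(s, t)"]) simp
qed

definition quad_coeffs :: "'a::finite_field \<times> 'a" where
  "quad_coeffs = (SOME p. \<forall>x. x * x \<noteq> fst p * x + snd p)"

definition quad_tr :: "'a::finite_field" where "quad_tr = fst quad_coeffs"
definition quad_c :: "'a::finite_field" where "quad_c = snd quad_coeffs"

lemma quad_irreducible: "x * x \<noteq> quad_tr * x + (quad_c :: 'a::finite_field)"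
  using someI_ex[OF irreducible_quadratic_exists[where ?'a = 'a]]
  by (auto simp: quad_tr_def quad_c_def quad_coeffs_def)

text \<open>\<open>Quad a b\<close> stands for \<open>a + b \<omega>\<close>, where \<open>\<omega>\<^sup>2 = quad_tr * \<omega> + quad_c\<close>; it has norm \<open>quad_norm a b\<close>
  over \<open>F_q\<close>.\<close>

datatype 'a quad = Quad (qre: 'a) (qim: 'a)

definition quad_norm :: "'a::finite_field \<Rightarrow> 'a \<Rightarrow> 'a" where
  "quad_norm a b = a * a + quad_tr * a * b - quad_c * b * b"

text \<open>A zero with nonzero \<open>b\<close> would make \<open>- a / b\<close> a root of the
  irreducible quadratic.\<close>

lemma quad_norm_eq_0_iff: "quad_norm a b = 0 \<longleftrightarrow> a = 0 \<and> b = 0"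
proof
  assume *: "quad_norm a b = 0"
  have "b = 0"
  proof (rule ccontr)
    assume "b \<noteq> 0"
    with quad_irreducible[of "- a / b"] * show False
      by (auto simp: quad_norm_def field_simps)
  qed
  with * show "a = 0 \<and> b = 0" by (auto simp: quad_norm_def)
qed (auto simp: quad_norm_def)

instantiation quad :: (finite_field) field
begin

definition "0 = Quad 0 0"
definition "1 = Quad 1 0"
definition "x + y = Quad (qre x + qre y) (qim x + qim y)"
definition "x - y = Quad (qre x - qre y) (qim x - qim y)"
definition "- x = Quad (- qre x) (- qim x)"
definition "x * y = Quad (qre x * qre y + quad_c * qim x * qim y)
   (qre x * qim y + qim x * qre y + quad_tr * qim x * qim y)"
text \<open>The conjugate divided by the norm; at 0 the division by zero gives 0, as the class
  requires.\<close>

definition "inverse x = Quad ((qre x + quad_tr * qim x) / quad_norm (qre x) (qim x))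
   (- qim x / quad_norm (qre x) (qim x))"
definition "x div y = x * inverse (y :: 'a quad)"

instance
proof
  fix x y z :: "'a quad"
  show "x * y * z = x * (y * z)" "x * y = y * x" "(x + y) * z = x * z + y * z"
    by (simp_all add: times_quad_def plus_quad_def algebra_simps)
  show "inverse x * x = 1" if "x \<noteq> 0"
  proof -
    have nz: "quad_norm (qre x) (qim x) \<noteq> 0"
      using that by (cases x) (auto simp: quad_norm_eq_0_iff zero_quad_def)
    have "(qre x + quad_tr * qim x) * qre x - quad_c * qim x * qim x = quad_norm (qre x) (qim x)"
      by (simp add: quad_norm_def algebra_simps)
    with nz show ?thesis
      by (simp add: times_quad_def inverse_quad_def one_quad_def divide_simps) (simp add: algebra_simps)
  qed
qed (auto simp: zero_quad_def one_quad_def plus_quad_def minus_quad_def uminus_quad_def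
    times_quad_def inverse_quad_def divide_quad_def quad_norm_def)

end

lemma quad_sel [simp]:
  "qre (0 :: 'a::finite_field quad) = 0" "qim (0 :: 'a quad) = 0"
  "qre (x + y :: 'a quad) = qre x + qre y" "qim (x + y) = qim x + qim y"
  "qre (x * y) = qre x * qre y + quad_c * qim x * qim y"
  "qim (x * y) = qre x * qim y + qim x * qre y + quad_tr * qim x * qim y"
  by (simp_all add: zero_quad_def plus_quad_def times_quad_def)

lemma card_UNIV_quad: "CARD('a::finite quad) = CARD('a) ^ 2"
proof -
  have "bij (\<lambda>(a, b). Quad a b)"
    by (auto simp: bij_def inj_def surj_def) (metis quad.exhaust)
  then have "CARD('a quad) = CARD('a \<times> 'a)" by (metis bij_betw_same_card)
  then show ?thesis by (simp add: power2_eq_square)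
qed

subsection \<open>Lagrange weights\<close>

text \<open>For \<open>a\<close> in a finite \<open>A\<close>, the leading coefficient of the
  Lagrange basis polynomial at \<open>a\<close>.\<close>

definition lagrange_weight :: "'a::field set \<Rightarrow> 'a \<Rightarrow> 'a" where
  "lagrange_weight A a = inverse (\<Prod>l\<in>A - {a}. a - l)"

lemma lagrange_weight_nonzero: "finite A \<Longrightarrow> lagrange_weight A a \<noteq> 0"
  by (simp add: lagrange_weight_def)

text \<open>The sum is the coefficient of degree \<open>card A - 1\<close> in the interpolation of \<open>x ^ j\<close> on \<open>A\<close>,
  which reproduces \<open>x ^ j\<close>.\<close>

lemma sum_lagrange_weight_power:
  fixes A :: "'a::field set"
  assumes fin: "finite A" and j: "j + 1 < card A"
  shows "(\<Sum>a\<in>A. lagrange_weight A a * a ^ j) = 0"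
proof -
  define L where "L a = (\<Prod>l\<in>A - {a}. [:- l, 1:])" for a :: 'a
  define P where "P = (\<Sum>a\<in>A. smult (lagrange_weight A a * a ^ j) (L a))"
  have deg: "degree (L a) = card A - 1" if "a \<in> A" for a
    unfolding L_def using that fin by (subst degree_prod_eq_sum_degree) auto
  have lead: "coeff (L a) (card A - 1) = 1" if "a \<in> A" for a
    using lead_coeff_prod[of "\<lambda>l. [:- l, 1:]" "A - {a}"] deg[OF that] by (simp add: L_def)
  \<comment> \<open>Both sides have degree below \<open>card A\<close> and agree on
    \<open>A\<close>.\<close>
  have "P = monom 1 j"
  proof (rule poly_eqI_degree)
    fix x assume x: "x \<in> A"
    have "poly (L a) x = 0" if "a \<in> A" "a \<noteq> x" for a
      using that x fin by (auto simp: L_def poly_prod)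
    then have "poly P x = lagrange_weight A x * x ^ j * poly (L x) x"
      using x fin by (simp add: P_def poly_sum sum.remove)
    also have "\<dots> = x ^ j"
      using fin by (simp add: L_def lagrange_weight_def poly_prod)
    finally show "poly P x = poly (monom 1 j) x" by (simp add: poly_monom)
  next
    have "degree P \<le> card A - 1"
      unfolding P_def using fin deg
      by (intro degree_sum_le) (auto intro: order.trans[OF degree_smult_le])
    then show "degree P < card A" using j by simp
    show "degree (monom (1 :: 'a) j) < card A" using j by (simp add: degree_monom_eq)
  qed
  then have "coeff P (card A - 1) = 0" using j by simp
  then show ?thesis using lead by (simp add: P_def coeff_sum)
qed

text \<open>Polynomial functions of total degree at most \<open>e\<close>. The inductive form lets
  weight identities be checked on monomials.\<close>

inductive bipoly :: "nat \<Rightarrow> ('a::comm_ring_1 \<Rightarrow> 'a \<Rightarrow> 'a) \<Rightarrow> bool" where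
  monomial: "s + t \<le> e \<Longrightarrow> bipoly e (\<lambda>x y. c * x ^ s * y ^ t)"
| add: "bipoly e F \<Longrightarrow> bipoly e G \<Longrightarrow> bipoly e (\<lambda>x y. F x y + G x y)"

lemma bipoly_const: "bipoly e (\<lambda>x y. c)"
  using bipoly.monomial[of 0 0 e c] by simp

lemma bipoly_fst: "1 \<le> e \<Longrightarrow> bipoly e (\<lambda>x y. x)"
  using bipoly.monomial[of 1 0 e 1] by simp

lemma bipoly_snd: "1 \<le> e \<Longrightarrow> bipoly e (\<lambda>x y. y)"
  using bipoly.monomial[of 0 1 e 1] by simp

lemma bipoly_mult:
  assumes "bipoly d F" "bipoly e G"
  shows "bipoly (d + e) (\<lambda>x y. F x y * G x y)"
  using assms(1)
proof (induction rule: bipoly.induct)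
  case (monomial s t d c)
  from assms(2) monomial show ?case
  proof (induction rule: bipoly.induct)
    case (monomial s' t' e c')
    then show ?case
      using bipoly.monomial[of "s + s'" "t + t'" "d + e" "c * c'"]
      by (simp add: power_add algebra_simps)
  next
    case (add e F G)
    then show ?case
      using bipoly.add[of "d + e"] by (simp add: distrib_left)
  qed
next
  case (add d F1 F2)
  then show ?case
    using bipoly.add[of "d + e"] by (simp add: distrib_right)
qed

lemma bipoly_diff:
  assumes "bipoly e F" "bipoly e G"
  shows "bipoly e (\<lambda>x y. F x y - G x y)"
  using bipoly.add[OF assms(1) bipoly_mult[OF bipoly_const[of 0 "- 1"] assms(2), simplified]] by simp

text \<open>In coordinates, multiplication by \<open>Quad x y\<close> is linear in \<open>x\<close>
  and \<open>y\<close>, so each Horner step raises the total degree by at most one.\<close>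

lemma bipoly_poly:
  fixes f :: "'a::finite_field quad poly"
  assumes "degree f \<le> e"
  shows "bipoly e (\<lambda>x y. qre (poly f (Quad x y))) \<and> bipoly e (\<lambda>x y. qim (poly f (Quad x y)))"
  using assms
proof (induction f arbitrary: e)
  case 0
  then show ?case by (simp add: bipoly_const)
next
  case (pCons c f)
  show ?case
  proof (cases "f = 0")
    case True
    then show ?thesis by (simp add: bipoly_const)
  next
    case False
    with pCons.prems obtain d where e: "e = 1 + d" "degree f \<le> d"
      by (cases e) auto
    from pCons.IH[OF e(2)] have f: "bipoly d (\<lambda>x y. qre (poly f (Quad x y)))"
      "bipoly d (\<lambda>x y. qim (poly f (Quad x y)))" by auto
    note prods = bipoly_mult[OF bipoly_fst[OF order.refl] f(1)] bipoly_mult[OF bipoly_fst[OF order.refl] f(2)]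
      bipoly_mult[OF bipoly_snd[OF order.refl] f(1)] bipoly_mult[OF bipoly_snd[OF order.refl] f(2)]
    have cmult: "bipoly (1 + d) (\<lambda>x y. a * G x y)" if "bipoly (1 + d) G" for a :: 'a and G
      using bipoly_mult[OF bipoly_const[of 0 a] that] by simp
    show ?thesis
      unfolding e(1) using prods cmult[OF prods(3)] cmult[OF prods(4)]
      by (simp add: mult.assoc bipoly.add bipoly_const)
  qed
qed

section \<open>Weights on grids\<close>

definition grid_weight :: "'a::field set \<Rightarrow> 'a set \<Rightarrow> 'a \<times> 'a \<Rightarrow> 'a" where
  "grid_weight A T p = lagrange_weight A (fst p) * lagrange_weight T (snd p)"

text \<open>For a monomial the sum factors over \<open>A\<close> and \<open>T\<close>. The degree
  bound prevents both exponents from being too large, so one factor vanishes.\<close>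

lemma sum_grid_weight:
  assumes fin: "finite A" "finite T" and "bipoly e F" "e + 2 < card A + card T"
  shows "(\<Sum>p\<in>A \<times> T. grid_weight A T p * F (fst p) (snd p)) = 0"
  using assms(3,4)
proof (induction rule: bipoly.induct)
  case (monomial s t e c)
  have "(\<Sum>p\<in>A \<times> T. grid_weight A T p * (c * fst p ^ s * snd p ^ t)) =
      c * (\<Sum>a\<in>A. \<Sum>b\<in>T. lagrange_weight A a * a ^ s * (lagrange_weight T b * b ^ t))"
    by (simp add: sum.cartesian_product grid_weight_def sum_distrib_left case_prod_beta algebra_simps)
  also have "\<dots> = c * ((\<Sum>a\<in>A. lagrange_weight A a * a ^ s) * (\<Sum>b\<in>T. lagrange_weight T b * b ^ t))"
    by (simp add: sum_product)
  also have "\<dots> = 0"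
  proof (cases "s + 1 < card A")
    case True
    then show ?thesis using sum_lagrange_weight_power[OF fin(1)] by simp
  next
    case False
    with monomial have "t + 1 < card T" by linarith
    then show ?thesis using sum_lagrange_weight_power[OF fin(2)] by simp
  qed
  finally show ?case .
next
  case (add e F G)
  then show ?case by (simp add: distrib_left sum.distrib)
qed

subsection \<open>Evaluation codes over the quadratic extension\<close>

text \<open>Bounding the degree through coefficients keeps the zero polynomial in the set even for
  \<open>m = 0\<close>.\<close>

lemma card_poly_degree_less:
  "card {f :: 'b::{finite, comm_semiring_1} poly. \<forall>i\<ge>m. coeff f i = 0} = CARD('b) ^ m"
proof -
  let ?P = "{f :: 'b poly. \<forall>i\<ge>m. coeff f i = 0}" and ?L = "{xs :: 'b list. set xs \<subseteq> UNIV \<and> length xs = m}"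
  have "bij_betw (\<lambda>f. map (coeff f) [0..<m]) ?P ?L"
  proof (rule bij_betw_byWitness[where f' = Poly])
    show "\<forall>f\<in>?P. Poly (map (coeff f) [0..<m]) = f"
      by (auto simp: poly_eq_iff nth_default_def)
    show "\<forall>xs\<in>?L. map (coeff (Poly xs)) [0..<m] = xs"
      by (auto simp: list_eq_iff_nth_eq nth_default_def)
  qed (auto simp: nth_default_def)
  then show ?thesis
    using card_lists_length_eq[of "UNIV :: 'b set" m] by (simp add: bij_betw_same_card)
qed

instance quad :: (finite) finite
proof
  have "(UNIV :: 'a quad set) = (\<lambda>(a, b). Quad a b) ` UNIV"
    by (auto simp: image_iff) (metis quad.exhaust)
  then show "finite (UNIV :: 'a quad set)" by (metis finite_imageI finite_class.finite_UNIV)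
qed

lemma coeff_eq_0_above_imp_degree: "\<forall>i\<ge>m. coeff f i = 0 \<Longrightarrow> f \<noteq> 0 \<Longrightarrow> degree f < m"
  by (metis leading_coeff_0_iff not_le)

text \<open>Generalized Reed-Solomon codes over \<open>F_{q^2}\<close>, read over \<open>F_q\<close>. The multipliers \<open>u i\<close> scale
  only the first half of a word; this multiplies the \<open>i\<close>-th summand of the symplectic form by \<open>u i\<close>,
  so that no solution of \<open>v\<^sup>q\<^sup>+\<^sup>1 = u i\<close> is needed.\<close>

lemma self_orthogonal_code_from_weights:
  fixes \<alpha> :: "nat \<Rightarrow> 'a::finite_field quad" and u :: "nat \<Rightarrow> 'a"
  assumes inj: "inj_on \<alpha> {..<n}" and nz: "\<And>i. i < n \<Longrightarrow> u i \<noteq> 0" and "m \<le> n"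
    and orth: "\<And>e F. e + 2 \<le> 2 * m \<Longrightarrow> bipoly e F \<Longrightarrow>
                 (\<Sum>i<n. u i * F (qre (\<alpha> i)) (qim (\<alpha> i))) = 0"
  shows "\<exists>D :: ('a vec \<times> 'a vec) set. linear_code n D \<and> D \<subseteq> symp_dual n D \<and> card D = CARD('a) ^ (2 * m) \<and>
    (\<forall>v\<in>symp_dual n D. v \<noteq> pzero n \<longrightarrow> m + 1 \<le> swt v)"
proof -
  define Pm :: "'a quad poly set" where "Pm = {f. \<forall>i\<ge>m. coeff f i = 0}"
  define ev where "ev f = (vec n (\<lambda>i. u i * qre (poly f (\<alpha> i))), vec n (\<lambda>i. qim (poly f (\<alpha> i))))" for f
  define D where "D = ev ` Pm"
  have evs: "ev f \<in> symp_space n" for f by (auto simp: ev_def symp_space_def)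
  have D: "linear_code n D"
    unfolding linear_code_iff
  proof (intro conjI ballI allI)
    show "D \<subseteq> symp_space n" using evs by (auto simp only: D_def)
    have "pzero n = ev 0" by (auto simp: ev_def)
    then show "pzero n \<in> D" by (simp add: D_def Pm_def)
    show "padd v w \<in> D" if vw: "v \<in> D" "w \<in> D" for v w
    proof -
      from vw obtain f g where "f \<in> Pm" "v = ev f" "g \<in> Pm" "w = ev g" by (auto simp only: D_def)
      moreover have "padd (ev f) (ev g) = ev (f + g)"
        by (auto simp: ev_def padd_def algebra_simps)
      ultimately show ?thesis by (auto simp: D_def Pm_def)
    qed
    show "psmult a v \<in> D" if v: "v \<in> D" for a v
    proof -
      from v obtain f where "f \<in> Pm" "v = ev f" by (auto simp only: D_def)
      moreover have "psmult a (ev f) = ev (smult (Quad a 0) f)"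
        by (auto simp: ev_def psmult_def)
      ultimately show ?thesis by (auto simp: D_def Pm_def)
    qed
  qed
  have Ds: "v \<in> symp_space n" if "v \<in> D" for v using linear_code_subset[OF D] that by (rule subsetD)
  have dual: "symp_dual n D = {v \<in> symp_space n. \<forall>c\<in>D. symp_form v c = 0}"
    by (rule symp_dual_linear[OF D])
  have "inj_on ev Pm"
  proof (rule inj_onI)
    fix f g assume fg: "f \<in> Pm" "g \<in> Pm" "ev f = ev g"
    show "f = g"
    proof (rule ccontr)
      assume "f \<noteq> g"
      then have deg: "degree (f - g) < m"
        using fg by (intro coeff_eq_0_above_imp_degree) (auto simp: Pm_def)
      have "poly f (\<alpha> i) = poly g (\<alpha> i)" if "i < n" for i
        using fg(3) nz[OF that] that by (auto simp: ev_def vec_eq_iff intro: quad.expand)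
      then have "\<alpha> ` {..<n} \<subseteq> {x. poly (f - g) x = 0}" by auto
      then have "card (\<alpha> ` {..<n}) \<le> card {x. poly (f - g) x = 0}"
        using \<open>f \<noteq> g\<close> by (intro card_mono poly_roots_finite) auto
      also have "\<dots> \<le> degree (f - g)"
        using \<open>f \<noteq> g\<close> by (intro card_poly_roots_bound) auto
      finally show False using deg \<open>m \<le> n\<close> inj by (simp add: card_image)
    qed
  qed
  then have card: "card D = CARD('a) ^ (2 * m)"
    by (simp add: D_def card_image Pm_def card_poly_degree_less card_UNIV_quad power_mult)
  have "symp_form (ev f) (ev g) = 0" if "f \<in> Pm" "g \<in> Pm" for f g
  proof (cases "f = 0 \<or> g = 0")
    case True
    then show ?thesis by (auto simp: ev_def symp_form_def scalar_prod_def)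
  next
    case False
    then have deg: "degree f < m" "degree g < m"
      using that by (auto simp: Pm_def intro: coeff_eq_0_above_imp_degree)
    \<comment> \<open>The summand of the form at a point, without its multiplier. Its degree is at
      most \<open>2 * m - 2\<close>, which is what \<open>orth\<close> covers.\<close>
    let ?F = "\<lambda>x y. qre (poly g (Quad x y)) * qim (poly f (Quad x y)) -
                    qre (poly f (Quad x y)) * qim (poly g (Quad x y))"
    have "bipoly (degree g + degree f) ?F"
      using bipoly_mult[of "degree f" _ "degree g"] bipoly_mult[of "degree g" _ "degree f"]
        bipoly_poly[OF order.refl, of f] bipoly_poly[OF order.refl, of g]
      by (intro bipoly_diff) (auto simp: add.commute)
    then have "(\<Sum>i<n. u i * ?F (qre (\<alpha> i)) (qim (\<alpha> i))) = 0"
      using deg by (intro orth) auto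
    moreover have "symp_form (ev f) (ev g) = (\<Sum>i<n. u i * ?F (qre (\<alpha> i)) (qim (\<alpha> i)))"
      by (simp add: ev_def symp_form_def scalar_prod_def sum_subtractf[symmetric] algebra_simps
          lessThan_atLeast0)
    ultimately show ?thesis by simp
  qed
  then have "D \<subseteq> symp_dual n D"
    unfolding dual using evs by (simp add: D_def image_subset_iff)
  moreover have "m + 1 \<le> swt v" if v: "v \<in> symp_dual n D" "v \<noteq> pzero n" for v
  proof (rule ccontr)
    assume "\<not> ?thesis"
    then have small: "swt v \<le> m" by simp
    have vs: "v \<in> symp_space n" using v by (simp add: dual)
    define I where "I = {i. i < n \<and> (fst v $ i, snd v $ i) \<noteq> (0, 0)}"
    have cI: "card I \<le> m" and fI: "finite I"
      using small vs by (auto simp: I_def swt_def symp_space_def)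
    have "I \<noteq> {}"
      using v(2) vs by (cases v) (auto simp: I_def symp_space_def vec_eq_iff)
    then obtain k where k: "k \<in> I" by auto
    \<comment> \<open>\<open>g\<close> vanishes at the support of \<open>v\<close> except at
      \<open>k\<close>, and the support is small enough for its multiples to give words of
      \<open>D\<close>.\<close>
    define g where "g = (\<Prod>i\<in>I - {k}. [:- \<alpha> i, 1:])"
    have "degree g = card (I - {k})"
      unfolding g_def by (subst degree_prod_eq_sum_degree) auto
    then have dg: "degree g < m"
      using cI k fI by (metis card_Diff1_less less_le_trans)
    have gk: "poly g (\<alpha> k) \<noteq> 0"
      using inj k fI by (auto simp: g_def poly_prod I_def inj_on_def)
    have g0: "poly g (\<alpha> i) = 0" if "i \<in> I" "i \<noteq> k" for i
      using that fI by (auto simp: g_def poly_prod)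
    \<comment> \<open>Rescaling \<open>g\<close> to take the value \<open>z\<close> at
      \<open>k\<close> leaves only the \<open>k\<close>-th summand. The choices
      \<open>Quad 1 0\<close> and \<open>Quad 0 1\<close> then annihilate both halves of
      \<open>v\<close> at \<open>k\<close>.\<close>
    have key: "u k * qre z * snd v $ k - fst v $ k * qim z = 0" for z
    proof -
      define f where "f = smult (z / poly g (\<alpha> k)) g"
      have "degree f < m" using dg degree_smult_le[of "z / poly g (\<alpha> k)" g] by (simp add: f_def)
      then have "f \<in> Pm" by (auto simp: Pm_def coeff_eq_0)
      then have "ev f \<in> D" by (simp add: D_def)
      then have "symp_form v (ev f) = 0" using v by (simp add: dual)
      moreover have "symp_form v (ev f) =
          (\<Sum>i<n. u i * qre (poly f (\<alpha> i)) * snd v $ i - fst v $ i * qim (poly f (\<alpha> i)))"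
        using vs by (auto simp: ev_def symp_form_def scalar_prod_def sum_subtractf symp_space_def
            lessThan_atLeast0)
      moreover have "\<dots> = (\<Sum>i\<in>{k}. u i * qre (poly f (\<alpha> i)) * snd v $ i - fst v $ i * qim (poly f (\<alpha> i)))"
      proof (rule sum.mono_neutral_right)
        show "\<forall>i\<in>{..<n} - {k}. u i * qre (poly f (\<alpha> i)) * snd v $ i - fst v $ i * qim (poly f (\<alpha> i)) = 0"
        proof
          fix i assume i: "i \<in> {..<n} - {k}"
          show "u i * qre (poly f (\<alpha> i)) * snd v $ i - fst v $ i * qim (poly f (\<alpha> i)) = 0"
          proof (cases "i \<in> I")
            case True
            then show ?thesis using g0[of i] i by (simp add: f_def)
          next
            case False
            then show ?thesis using i by (simp add: I_def)
          qed
        qed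
      qed (use k in \<open>auto simp: I_def\<close>)
      moreover have "poly f (\<alpha> k) = z" using gk by (simp add: f_def)
      ultimately show ?thesis by simp
    qed
    have "k < n" using k by (simp add: I_def)
    have "snd v $ k = 0" using key[of "Quad 1 0"] nz[OF \<open>k < n\<close>] by simp
    moreover have "fst v $ k = 0" using key[of "Quad 0 1"] by simp
    ultimately show False using k by (simp add: I_def)
  qed
  ultimately show ?thesis using D card by blast
qed

text \<open>Carries weights on a set of points of the plane to an enumeration of these points as
  elements of the quadratic extension.\<close>

lemma linear_MDS_from_weights:
  fixes S :: "('a::finite_field \<times> 'a) set"
  assumes nz: "\<And>p. p \<in> S \<Longrightarrow> u p \<noteq> 0"
    and orth: "\<And>e F. e + 2 \<le> 2 * m \<Longrightarrow> bipoly e F \<Longrightarrow> (\<Sum>p\<in>S. u p * F (fst p) (snd p)) = 0"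
    and "n = card S" "m < n" "2 * m + r \<le> n"
  shows "\<exists>C :: ('a vec \<times> 'a vec) set. linear_MDS C n (n - 2 * m - r) r (m + 1) \<and> pure_to n (m + 1) C"
proof -
  obtain h where h: "bij_betw h {..<n} S"
    using ex_bij_betw_nat_finite[of S] \<open>n = card S\<close> by (auto simp: lessThan_atLeast0)
  let ?\<alpha> = "\<lambda>i. Quad (fst (h i)) (snd (h i))"
  have inj: "inj_on ?\<alpha> {..<n}"
    using h by (auto simp: bij_betw_def inj_on_def prod_eq_iff)
  have hS: "h i \<in> S" if "i < n" for i
    using h that by (auto simp: bij_betw_def)
  obtain D :: "('a vec \<times> 'a vec) set" where "linear_code n D" "D \<subseteq> symp_dual n D"
    "card D = CARD('a) ^ (2 * m)" "\<forall>v\<in>symp_dual n D. v \<noteq> pzero n \<longrightarrow> m + 1 \<le> swt v"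
  proof -
    have "(\<Sum>i<n. u (h i) * F (qre (?\<alpha> i)) (qim (?\<alpha> i))) = 0" if "e + 2 \<le> 2 * m" "bipoly e F" for e F
      using sum.reindex_bij_betw[OF h, of "\<lambda>p. u p * F (fst p) (snd p)"] orth[OF that] by simp
    then have "\<exists>D :: ('a vec \<times> 'a vec) set. linear_code n D \<and> D \<subseteq> symp_dual n D \<and>
      card D = CARD('a) ^ (2 * m) \<and> (\<forall>v\<in>symp_dual n D. v \<noteq> pzero n \<longrightarrow> m + 1 \<le> swt v)"
      using nz[OF hS] \<open>m < n\<close>
      by (intro self_orthogonal_code_from_weights[OF inj, of "\<lambda>i. u (h i)"]) auto
    then show thesis using that by (elim exE conjE)
  qed
  then show ?thesis
    using linear_MDS_from_self_orthogonal[of n D m r] assms by metis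
qed

text \<open>The degrees to be annihilated satisfy \<open>e + 2 \<le> 2 * m\<close>, so
  \<open>2 * m < card A + card T\<close> is the condition of \<open>sum_grid_weight\<close>.\<close>

lemma linear_MDS_grid:
  fixes A T :: "'a::finite_field set"
  assumes "n = card A * card T" "2 * m < card A + card T" "m < n" "2 * m + r \<le> n"
  shows "\<exists>C :: ('a vec \<times> 'a vec) set. linear_MDS C n (n - 2 * m - r) r (m + 1) \<and> pure_to n (m + 1) C"
  by (rule linear_MDS_from_weights[of "A \<times> T" "grid_weight A T"])
    (use assms in \<open>auto simp: grid_weight_def lagrange_weight_nonzero card_cartesian_product
      intro!: sum_grid_weight[of A T, simplified]\<close>)

text \<open>Multiplying the weights on \<open>F_q\<^sup>2\<close> by the norm, a polynomial of degree 2, removes the origin.\<close>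

lemma linear_MDS_punctured_plane:
  assumes n: "n = CARD('a::finite_field) ^ 2 - 1" and m: "m + 1 < CARD('a)" and "m < n" "2 * m + r \<le> n"
  shows "\<exists>C :: ('a vec \<times> 'a vec) set. linear_MDS C n (n - 2 * m - r) r (m + 1) \<and> pure_to n (m + 1) C"
proof (rule linear_MDS_from_weights)
  let ?w = "grid_weight UNIV UNIV :: 'a \<times> 'a \<Rightarrow> 'a" and ?N = "\<lambda>p :: 'a \<times> 'a. quad_norm (fst p) (snd p)"
  let ?S = "UNIV - {(0, 0)} :: ('a \<times> 'a) set"
  show "?w p * ?N p \<noteq> 0" if "p \<in> ?S" for p
    using that by (auto simp: grid_weight_def lagrange_weight_nonzero quad_norm_eq_0_iff prod_eq_iff)
  show "n = card ?S"
    using n by (simp add: card_Diff_singleton power2_eq_square)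
  fix e and F :: "'a \<Rightarrow> 'a \<Rightarrow> 'a" assume e: "e + 2 \<le> 2 * m" "bipoly e F"
  have N: "bipoly 2 (quad_norm :: 'a \<Rightarrow> _)"
  proof -
    have "bipoly 2 (\<lambda>x y. (1 * x ^ 2 * y ^ 0 + quad_tr * x ^ 1 * y ^ 1) - quad_c * x ^ 0 * y ^ 2 :: 'a)"
      by (intro bipoly_diff bipoly.intros) auto
    then show ?thesis by (simp add: quad_norm_def[abs_def] power2_eq_square mult.assoc)
  qed
  \<comment> \<open>The norm costs two degrees: \<open>2 + e + 2 \<le> 2 * m + 2\<close>, which is
    below twice the field size because \<open>m + 1 < CARD('a)\<close>.\<close>
  have "(\<Sum>p\<in>UNIV \<times> UNIV. ?w p * (quad_norm (fst p) (snd p) * F (fst p) (snd p))) = 0"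
    using bipoly_mult[OF N e(2)] e(1) m by (intro sum_grid_weight[where e = "2 + e"]) auto
  also have "(\<Sum>p\<in>UNIV \<times> UNIV. ?w p * (quad_norm (fst p) (snd p) * F (fst p) (snd p))) =
    (\<Sum>p\<in>?S. ?w p * (quad_norm (fst p) (snd p) * F (fst p) (snd p)))"
    by (rule sum.mono_neutral_right) (auto simp: quad_norm_eq_0_iff)
  finally show "(\<Sum>p\<in>?S. ?w p * ?N p * F (fst p) (snd p)) = 0"
    by (simp add: mult.assoc)
qed (use assms in auto)

text \<open>Passes from natural to integer parameters; \<open>2 * m + r \<le> n\<close> makes the
  truncated subtraction exact.\<close>

lemma pure_linear_MDS_existsI:
  assumes "\<exists>C :: ('a::finite_field vec \<times> 'a vec) set. linear_MDS C n (n - 2 * m - r) r (m + 1) \<and> pure_to n (m + 1) C"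
    and "2 * m + r \<le> n"
    and "n' = int n" "k' = int n - 2 * int m - int r" "r' = int r" "d' = int m + 1"
  shows "pure_linear_MDS_exists TYPE('a) n' k' r' d'"
proof -
  have "nat k' = n - 2 * m - r" "nat d' = m + 1" using assms by linarith+
  with assms show ?thesis by (simp add: pure_linear_MDS_exists_def)
qed

section \<open>The six parameter families\<close>

theorem corollary20:
  fixes q :: int
  assumes q: "q = int CARD('a::finite_field)"
  shows
    "(\<forall>n d r :: int.
        3 \<le> n \<and> n \<le> q \<and> 1 \<le> d \<and> real_of_int d \<le> real_of_int n / 2 + 1 \<and>
        0 \<le> r \<and> r \<le> n - 2 * d + 1 \<longrightarrow>
        pure_linear_MDS_exists TYPE('a) n (n - 2 * d + 2 - r) r d) \<and>
     (\<forall>\<nu> r :: int.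
        0 \<le> \<nu> \<and> \<nu> \<le> q - 2 \<and> 0 \<le> r \<and> r \<le> (\<nu> + 1) * q - 2 * \<nu> - 3 \<longrightarrow>
        pure_linear_MDS_exists TYPE('a)
          ((\<nu> + 1) * q) ((\<nu> + 1) * q - 2 * \<nu> - 2 - r) r (\<nu> + 2)) \<and>
     (\<forall>\<delta> r :: int.
        0 \<le> \<delta> \<and> real_of_int \<delta> < real_of_int (q - 1) / 2 \<and>
        0 \<le> r \<and> r \<le> q - 2 * \<delta> - 1 \<longrightarrow>
        pure_linear_MDS_exists TYPE('a) (q - 1) (q - 1 - 2 * \<delta> - r) r (\<delta> + 1)) \<and>
     (\<forall>\<delta> r' :: int.
        0 \<le> \<delta> \<and> real_of_int \<delta> < real_of_int (q - 1) / 2 \<and>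
        0 \<le> r' \<and> r' < q - 2 * \<delta> - 2 \<longrightarrow>
        pure_linear_MDS_exists TYPE('a) q (q - 2 * \<delta> - 2 - r') r' (\<delta> + 2)) \<and>
     (\<forall>\<delta> r :: int.
        0 \<le> \<delta> \<and> \<delta> < q - 1 \<and> 0 \<le> r \<and> r < q\<^sup>2 - 2 * \<delta> - 1 \<longrightarrow>
        pure_linear_MDS_exists TYPE('a) (q\<^sup>2 - 1) (q\<^sup>2 - 2 * \<delta> - 1 - r) r (\<delta> + 1)) \<and>
     (\<forall>\<delta> r' :: int.
        0 \<le> \<delta> \<and> \<delta> < q - 1 \<and> 0 \<le> r' \<and> r' < q\<^sup>2 - 2 * \<delta> - 2 \<longrightarrow>
        pure_linear_MDS_exists TYPE('a) (q\<^sup>2) (q\<^sup>2 - 2 * \<delta> - 2 - r') r' (\<delta> + 2))"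
proof (intro conjI allI impI)
  let ?q = "CARD('a)"
  have q1: "?q > 1" by (rule card_field_gt_1)
  \<comment> \<open>The grid \<open>{0} \<times> T\<close> with \<open>n\<close> points serves all
    families of length at most \<open>q\<close>. With \<open>m = d - 1\<close>, the grid condition
    reads \<open>2 * d \<le> n + 2\<close>, and \<open>d \<le> n\<close> is
    \<open>m < n\<close>.\<close>
  have line: "pure_linear_MDS_exists TYPE('a) n (n - 2 * d + 2 - r) r d"
    if "1 \<le> n" "n \<le> q" "1 \<le> d" "2 * d \<le> n + 2" "d \<le> n" "0 \<le> r" "r \<le> n - 2 * d + 2" for n d r :: int
  proof -
    have "nat n \<le> CARD('a)" using that q by simp
    then obtain T :: "'a set" where T: "card T = nat n"
      using obtain_subset_with_card_n[of "nat n" "UNIV :: 'a set"] by auto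
    show ?thesis
      using linear_MDS_grid[of "nat n" "{0}" T "nat (d - 1)" "nat r"] T that
      by (intro pure_linear_MDS_existsI[of "nat n" "nat (d - 1)" "nat r"]) auto
  qed
  {
    fix n d r :: int
    assume *: "3 \<le> n \<and> n \<le> q \<and> 1 \<le> d \<and> real_of_int d \<le> real_of_int n / 2 + 1 \<and>
      0 \<le> r \<and> r \<le> n - 2 * d + 1"
    then have "real_of_int (2 * d) \<le> real_of_int (n + 2)" by simp
    then have "2 * d \<le> n + 2" by (simp only: of_int_le_iff)
    \<comment> \<open>The remaining condition \<open>d \<le> n\<close> follows from
      \<open>2 * d \<le> n + 2\<close> and \<open>3 \<le> n\<close>.\<close>
    with * show "pure_linear_MDS_exists TYPE('a) n (n - 2 * d + 2 - r) r d"
      by (intro line) auto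
  next
    fix \<nu> r :: int
    assume *: "0 \<le> \<nu> \<and> \<nu> \<le> q - 2 \<and> 0 \<le> r \<and> r \<le> (\<nu> + 1) * q - 2 * \<nu> - 3"
    have "nat (\<nu> + 1) \<le> ?q" using * q by linarith
    then obtain T :: "'a set" where T: "card T = nat (\<nu> + 1)"
      using obtain_subset_with_card_n[of "nat (\<nu> + 1)" "UNIV :: 'a set"] by auto
    define n where "n = ?q * card T"
    have n: "int n = (\<nu> + 1) * q"
      using T * q by (simp add: n_def)
    \<comment> \<open>Here \<open>m = \<nu> + 1\<close>, and \<open>q \<ge> 2\<close> yields
      \<open>m < n\<close>.\<close>
    have "(\<nu> + 1) * 2 \<le> (\<nu> + 1) * q"
      using * by (intro mult_left_mono) auto
    then have "nat (\<nu> + 1) < n" using n * by linarith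
    moreover have "2 * nat (\<nu> + 1) + nat r \<le> n" using n * by linarith
    moreover have "2 * nat (\<nu> + 1) < card (UNIV :: 'a set) + card T" using T q * by linarith
    ultimately show "pure_linear_MDS_exists TYPE('a)
        ((\<nu> + 1) * q) ((\<nu> + 1) * q - 2 * \<nu> - 2 - r) r (\<nu> + 2)"
      using linear_MDS_grid[of n "UNIV :: 'a set" T "nat (\<nu> + 1)" "nat r"] n *
      by (intro pure_linear_MDS_existsI[of n "nat (\<nu> + 1)" "nat r"]) (auto simp: n_def)
  next
    fix \<delta> r :: int
    assume *: "0 \<le> \<delta> \<and> real_of_int \<delta> < real_of_int (q - 1) / 2 \<and> 0 \<le> r \<and> r \<le> q - 2 * \<delta> - 1"
    then have "real_of_int (2 * \<delta>) < real_of_int (q - 1)" by simp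
    then have "2 * \<delta> < q - 1" by (simp only: of_int_less_iff)
    with * show "pure_linear_MDS_exists TYPE('a) (q - 1) (q - 1 - 2 * \<delta> - r) r (\<delta> + 1)"
      using line[of "q - 1" "\<delta> + 1" r] by (simp add: algebra_simps)
  next
    fix \<delta> r' :: int
    assume *: "0 \<le> \<delta> \<and> real_of_int \<delta> < real_of_int (q - 1) / 2 \<and> 0 \<le> r' \<and> r' < q - 2 * \<delta> - 2"
    then have "real_of_int (2 * \<delta>) < real_of_int (q - 1)" by simp
    then have "2 * \<delta> < q - 1" by (simp only: of_int_less_iff)
    with * show "pure_linear_MDS_exists TYPE('a) q (q - 2 * \<delta> - 2 - r') r' (\<delta> + 2)"
      using line[of q "\<delta> + 2" r'] by (simp add: algebra_simps)
  next
    fix \<delta> r :: int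
    assume *: "0 \<le> \<delta> \<and> \<delta> < q - 1 \<and> 0 \<le> r \<and> r < q\<^sup>2 - 2 * \<delta> - 1"
    define n where "n = ?q ^ 2 - 1"
    have n: "int n = q\<^sup>2 - 1"
      using q1 q by (simp add: n_def of_nat_diff)
    have "q * 2 \<le> q * q" using * by (intro mult_left_mono) auto
    then have "2 * q \<le> q\<^sup>2" by (simp add: power2_eq_square)
    then have "nat \<delta> < n" using n * by linarith
    moreover have "2 * nat \<delta> + nat r \<le> n" using n * by linarith
    moreover have "nat \<delta> + 1 < ?q" using q * by linarith
    ultimately show "pure_linear_MDS_exists TYPE('a) (q\<^sup>2 - 1) (q\<^sup>2 - 2 * \<delta> - 1 - r) r (\<delta> + 1)"
      using linear_MDS_punctured_plane[OF n_def, of "nat \<delta>" "nat r"] n *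
      by (intro pure_linear_MDS_existsI[of n "nat \<delta>" "nat r"]) auto
  next
    fix \<delta> r' :: int
    assume *: "0 \<le> \<delta> \<and> \<delta> < q - 1 \<and> 0 \<le> r' \<and> r' < q\<^sup>2 - 2 * \<delta> - 2"
    define n where "n = ?q * ?q"
    have n: "int n = q\<^sup>2" using q by (simp add: n_def power2_eq_square)
    have "q * 2 \<le> q * q" using * by (intro mult_left_mono) auto
    then have "2 * q \<le> q\<^sup>2" by (simp add: power2_eq_square)
    then have "nat (\<delta> + 1) < n" using n * by linarith
    moreover have "2 * nat (\<delta> + 1) + nat r' \<le> n" using n * by linarith
    \<comment> \<open>The full plane with \<open>m = \<delta> + 1\<close>: the grid condition is
      equivalent to \<open>\<delta> < q - 1\<close>.\<close>
    moreover have "2 * nat (\<delta> + 1) < ?q + ?q" using q * by linarith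
    ultimately show "pure_linear_MDS_exists TYPE('a) (q\<^sup>2) (q\<^sup>2 - 2 * \<delta> - 2 - r') r' (\<delta> + 2)"
      using linear_MDS_grid[of n "UNIV :: 'a set" "UNIV :: 'a set" "nat (\<delta> + 1)" "nat r'"] n *
      by (intro pure_linear_MDS_existsI[of n "nat (\<delta> + 1)" "nat r'"]) (auto simp: n_def)
  }
qed

end
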